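(* Let $\rho=(r_n)_n$ be an increasing sequence in $[0,1)$ with $r_n\to 1$. Let $w:[0,1)\to[1,\infty)$ be continuous and increasing with $w(r)\to\infty$ as $r\to1$. For any $A\subset\mathbb{D}$ such that $\overline{A}\cap\mathbb{T}$ contains exactly one point, there exists $f\in\mathcal{U}_A(\mathbb{D},\rho)$ such that $|f(z)|\le w(|z|)$ for all $z\in A$.
   Context: $\mathbb{D}$ is the open unit disc, $\mathbb{T}$ the unit circle. For $f\in H(\mathbb{D})$, $f_r(z):=f(rz)$; $\mathcal{U}_A(\mathbb{D},\rho)$ is the set of $f\in H(\mathbb{D})$ such that for every compact $K\subset\mathbb{T}$, $K\neq\mathbb{T}$, and every continuous $\varphi$ on $K$ there is an increasing sequence $(n_k)$ with $\sup_{\zeta\in K}|f_{r_{n_k}}(\zeta)-\varphi(\zeta)|\to0$. *)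

theory Defs
  imports "HOL-Analysis.Analysis"
begin

definition dilate :: "(complex \<Rightarrow> complex) \<Rightarrow> real \<Rightarrow> complex \<Rightarrow> complex" where
  "dilate f r = (\<lambda>z. f (complex_of_real r * z))"

definition U_A :: "(nat \<Rightarrow> real) \<Rightarrow> (complex \<Rightarrow> complex) set" where
  "U_A \<rho> = {f. f holomorphic_on ball 0 1 \<and>
     (\<forall>K \<phi>. compact K \<and> K \<subseteq> sphere 0 1 \<and> K \<noteq> sphere 0 1 \<and> continuous_on K \<phi> \<longrightarrow>
        (\<exists>n::nat \<Rightarrow> nat. strict_mono n \<and>
           uniform_limit K (\<lambda>k. dilate f (\<rho> (n k))) \<phi> sequentially))}"

end

theory Submission
  imports Defs "HOL-Complex_Analysis.Complex_Analysis"
begin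

text \<open>
  Let \<open>\<zeta>\<close> be the limit point of \<open>A\<close> on the circle. The function \<open>f\<close> is the limit of entire functions
  \<open>F\<^sub>k\<close>; each step adds a correction \<open>P\<close> that is tiny on a large disc, makes \<open>F\<^sub>k + P\<close> close to a given
  target \<open>\<phi>\<close> on a given compact set \<open>r\<^sub>n K\<close>, and is bounded on all of \<open>A\<close> by a constant that depends
  only on \<open>F\<^sub>k\<close> and \<open>\<phi>\<close>, not on how large the disc is. So the disc can be chosen so large that \<open>w\<close>
  exceeds all bounds outside it, and the growth condition survives the limit.

  If \<open>\<zeta> \<in> K\<close>, the correction has to reach the value \<open>c = \<phi>(\<zeta>) - F\<^sub>k(\<zeta>)\<close> inside \<open>A\<close>. This is done by
  \<open>c h\<close>, where \<open>h\<close> is a power of the peak function \<open>(1 + \<zeta>\<^sup>* z) / 2\<close>, so that \<open>|h| \<le> 1\<close> on the disc. The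
  remaining target vanishes at \<open>\<zeta>\<close> and may be replaced by a continuous \<open>\<psi>\<close> that vanishes near \<open>\<zeta>\<close>. A
  discrete Poisson integral of \<open>\<psi>\<close> is a rational function close to \<open>\<psi>\<close> on the circle and close to \<open>0\<close> on
  a smaller disc and near \<open>\<zeta>\<close>. Its poles lie near the support of \<open>\<psi>\<close>, and as \<open>K\<close> misses a
  point \<open>\<eta> \<noteq> \<zeta>\<close> of the circle they can be pushed to infinity through the gap at \<open>\<eta>\<close>.
\<close>

section \<open>Uniform approximation by entire functions\<close>

definition entire_approx :: "complex set \<Rightarrow> (complex \<Rightarrow> complex) \<Rightarrow> bool" where
  "entire_approx B u \<longleftrightarrow>
     (\<forall>e>0. \<exists>p. p holomorphic_on UNIV \<and> (\<forall>z\<in>B. cmod (u z - p z) < e))"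

lemma entire_approx_entire: "u holomorphic_on UNIV \<Longrightarrow> entire_approx B u"
  unfolding entire_approx_def by (intro allI impI exI[of _ u]) auto

lemma entire_approx_add:
  assumes "entire_approx B u" "entire_approx B v"
  shows "entire_approx B (\<lambda>z. u z + v z)"
  unfolding entire_approx_def
proof (intro allI impI)
  fix e :: real assume "e > 0"
  then obtain p q where p: "p holomorphic_on UNIV" "\<And>z. z \<in> B \<Longrightarrow> cmod (u z - p z) < e/2"
    and q: "q holomorphic_on UNIV" "\<And>z. z \<in> B \<Longrightarrow> cmod (v z - q z) < e/2"
    using assms unfolding entire_approx_def by (meson half_gt_zero)
  have "cmod (u z + v z - (p z + q z)) < e" if "z \<in> B" for z
    using p(2)[OF that] q(2)[OF that] norm_diff_triangle_ineq[of "u z" "v z" "p z" "q z"] by linarith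
  then show "\<exists>p. p holomorphic_on UNIV \<and> (\<forall>z\<in>B. cmod (u z + v z - p z) < e)"
    using p(1) q(1) by (intro exI[of _ "\<lambda>z. p z + q z"]) (auto intro!: holomorphic_intros)
qed

text \<open>The error is \<open>v z * (u z - p z) + p z * (v z - q z)\<close>, so bounds on the
  factors are needed to control it.\<close>

lemma entire_approx_mult:
  assumes "entire_approx B u" "entire_approx B v" "bounded (u ` B)" "bounded (v ` B)"
  shows "entire_approx B (\<lambda>z. u z * v z)"
  unfolding entire_approx_def
proof (intro allI impI)
  fix e :: real assume "e > 0"
  obtain M where M: "M > 0" "\<And>z. z \<in> B \<Longrightarrow> cmod (u z) \<le> M" "\<And>z. z \<in> B \<Longrightarrow> cmod (v z) \<le> M"
  proof -
    obtain a where "a > 0" "\<forall>x\<in>u ` B. cmod x \<le> a" using assms(3) bounded_pos by metis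
    moreover obtain b where "b > 0" "\<forall>x\<in>v ` B. cmod x \<le> b" using assms(4) bounded_pos by metis
    ultimately show ?thesis by (intro that[of "max a b"]) (auto simp: le_max_iff_disj)
  qed
  \<comment> \<open>The cap 1 keeps \<open>cmod (p z)\<close> below \<open>M + 1\<close>; the two
    error terms are then bounded by \<open>M * d\<close> and \<open>(M + 1) * d\<close>.\<close>
  define d where "d = min 1 (e / (2 * M + 1))"
  have d: "d > 0" "d \<le> 1" "d * (2 * M + 1) \<le> e"
  proof -
    show "d > 0" "d \<le> 1" using \<open>e > 0\<close> M by (auto simp: d_def)
    have "d \<le> e / (2 * M + 1)" by (simp add: d_def)
    then show "d * (2 * M + 1) \<le> e" using M(1) by (simp add: pos_le_divide_eq)
  qed
  obtain p q where p: "p holomorphic_on UNIV" "\<And>z. z \<in> B \<Longrightarrow> cmod (u z - p z) < d"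
    and q: "q holomorphic_on UNIV" "\<And>z. z \<in> B \<Longrightarrow> cmod (v z - q z) < d"
    using assms d(1) unfolding entire_approx_def by meson
  have "cmod (u z * v z - p z * q z) < e" if z: "z \<in> B" for z
  proof -
    have "cmod (p z) \<le> M + 1"
      using p(2)[OF z] M(2)[OF z] d(2) norm_triangle_ineq2[of "p z" "u z"] norm_minus_commute[of "p z" "u z"]
      by linarith
    then have "cmod (p z) * cmod (v z - q z) \<le> (M + 1) * d"
      using q(2)[OF z] M by (intro mult_mono) auto
    moreover have "cmod (v z) * cmod (u z - p z) < M * d \<or> v z = 0 "
      using p(2)[OF z] M(3)[OF z] M(1)
      by (metis mult_le_less_imp_less norm_ge_zero norm_le_zero_iff not_le)
    then have "cmod (v z) * cmod (u z - p z) < M * d" using M d by auto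
    moreover have "u z * v z - p z * q z = v z * (u z - p z) + p z * (v z - q z)"
      by (simp add: algebra_simps)
    then have "cmod (u z * v z - p z * q z) \<le> cmod (v z) * cmod (u z - p z) + cmod (p z) * cmod (v z - q z)"
      by (metis norm_triangle_ineq norm_mult)
    ultimately show ?thesis using d(3) by (simp add: algebra_simps)
  qed
  then show "\<exists>p. p holomorphic_on UNIV \<and> (\<forall>z\<in>B. cmod (u z * v z - p z) < e)"
    using p(1) q(1) by (intro exI[of _ "\<lambda>z. p z * q z"]) (auto intro!: holomorphic_intros)
qed

lemma entire_approx_cmult:
  assumes "entire_approx B u"
  shows "entire_approx B (\<lambda>z. c * u z)"
  unfolding entire_approx_def
proof (intro allI impI)
  fix e :: real assume e: "e > 0"
  then have pos: "e / (cmod c + 1) > 0" by (simp add: add_nonneg_pos)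
  then obtain p where p: "p holomorphic_on UNIV" "\<And>z. z \<in> B \<Longrightarrow> cmod (u z - p z) < e / (cmod c + 1)"
    using assms unfolding entire_approx_def by meson
  have "cmod (c * u z - c * p z) < e" if "z \<in> B" for z
  proof -
    have "cmod (c * u z - c * p z) = cmod c * cmod (u z - p z)"
      by (simp add: norm_mult flip: right_diff_distrib)
    also have "\<dots> \<le> cmod c * (e / (cmod c + 1))"
      using p(2)[OF that] by (intro mult_left_mono) auto
    also have "\<dots> < e"
    proof -
      have "cmod c * e < e * (cmod c + 1)" using e by (simp add: algebra_simps)
      then show ?thesis by (simp add: pos_divide_less_eq add_nonneg_pos)
    qed
    finally show ?thesis .
  qed
  then show "\<exists>p. p holomorphic_on UNIV \<and> (\<forall>z\<in>B. cmod (c * u z - p z) < e)"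
    using p(1) by (intro exI[of _ "\<lambda>z. c * p z"]) (auto intro!: holomorphic_intros)
qed

lemma entire_approx_sum:
  assumes "\<And>i. i \<in> I \<Longrightarrow> entire_approx B (u i)"
  shows "entire_approx B (\<lambda>z. \<Sum>i\<in>I. u i z)"
  using assms
proof (induction I rule: infinite_finite_induct)
  case (insert i I)
  then show ?case by (simp add: entire_approx_add)
qed (auto intro: entire_approx_entire)

lemma entire_approx_limit:
  assumes "\<And>e. e > 0 \<Longrightarrow> \<exists>v. entire_approx B v \<and> (\<forall>z\<in>B. cmod (u z - v z) < e)"
  shows "entire_approx B u"
  unfolding entire_approx_def
proof (intro allI impI)
  fix e :: real assume "e > 0"
  then obtain v where v: "entire_approx B v" "\<And>z. z \<in> B \<Longrightarrow> cmod (u z - v z) < e/2"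
    using assms half_gt_zero by meson
  then obtain p where p: "p holomorphic_on UNIV" "\<And>z. z \<in> B \<Longrightarrow> cmod (v z - p z) < e/2"
    unfolding entire_approx_def using \<open>e > 0\<close> half_gt_zero by meson
  have "cmod (u z - p z) < e" if "z \<in> B" for z
    using norm_triangle_lt[of "u z - v z" "v z - p z" e] v(2)[OF that] p(2)[OF that] by simp
  then show "\<exists>p. p holomorphic_on UNIV \<and> (\<forall>z\<in>B. cmod (u z - p z) < e)" using p by blast
qed

lemma entire_approx_power:
  assumes "entire_approx B u" "bounded (u ` B)"
  shows "entire_approx B (\<lambda>z. u z ^ k) \<and> bounded ((\<lambda>z. u z ^ k) ` B)"
proof (induction k)
  case 0
  show ?case by (auto intro!: entire_approx_entire simp: image_constant_conv)
next
  case (Suc k)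
  obtain M where M: "\<forall>x\<in>u ` B. cmod x \<le> M" using assms(2) bounded_pos by metis
  have "bounded ((\<lambda>z. u z ^ Suc k) ` B)"
    unfolding bounded_iff using M by (intro exI[of _ "M ^ Suc k"]) (auto simp del: power_Suc simp: norm_power intro!: power_mono)
  then show ?case using Suc entire_approx_mult[OF assms(1) _ assms(2)] by auto
qed

section \<open>Geometric series and the pushing of poles\<close>

lemma entire_approx_geometric:
  assumes u: "entire_approx B u" "\<And>z. z \<in> B \<Longrightarrow> cmod (u z) \<le> q" and q: "q < 1"
  shows "entire_approx B (\<lambda>z. 1 / (1 - u z))"
proof (cases "B = {}")
  case True
  then show ?thesis by (auto simp: entire_approx_def intro: holomorphic_on_const)
next
  case False
  then have q0: "q \<ge> 0" using u(2) norm_ge_zero order_trans by blast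
  have bdd: "bounded (u ` B)" unfolding bounded_iff using u(2) by auto
  show ?thesis
  proof (rule entire_approx_limit)
    fix e :: real assume e: "e > 0"
    have "(\<lambda>N. q ^ N) \<longlonglongrightarrow> 0" using q q0 by (intro LIMSEQ_power_zero) auto
    then have "\<forall>\<^sub>F N in sequentially. q ^ N < e * (1 - q)"
      using e q by (intro order_tendstoD) auto
    then obtain N where N: "q ^ N < e * (1 - q)" using eventually_happens'[OF sequentially_bot] by blast
    have "cmod (1 / (1 - u z) - (\<Sum>k<N. u z ^ k)) < e" if z: "z \<in> B" for z
    proof -
      have ne: "u z \<noteq> 1" using u(2)[OF z] q by auto
      then have "1 / (1 - u z) - (\<Sum>k<N. u z ^ k) = u z ^ N / (1 - u z)"
        by (simp add: sum_gp_strict field_simps)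
      moreover have "1 - q \<le> cmod (1 - u z)"
        using u(2)[OF z] norm_triangle_ineq2[of 1 "u z"] by simp
      moreover have "cmod (u z) ^ N \<le> q ^ N" using u(2)[OF z] by (intro power_mono) auto
      ultimately have "cmod (1 / (1 - u z) - (\<Sum>k<N. u z ^ k)) \<le> q ^ N / (1 - q)"
        using q q0 by (simp add: norm_divide norm_power frac_le)
      also have "\<dots> < e" using N q by (simp add: pos_divide_less_eq)
      finally show ?thesis .
    qed
    moreover have "entire_approx B (\<lambda>z. \<Sum>k<N. u z ^ k)"
      using entire_approx_power[OF u(1) bdd] by (intro entire_approx_sum) auto
    ultimately show "\<exists>v. entire_approx B v \<and> (\<forall>z\<in>B. cmod (1 / (1 - u z) - v z) < e)" by blast
  qed
qed

text \<open>Expanding about the old pole, \<open>1 / (z - b)\<close> is \<open>1 / (z - a)\<close>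
  times a geometric series in \<open>(b - a) / (z - a)\<close>, whose modulus on \<open>B\<close> is
  at most \<open>q\<close>.\<close>

lemma entire_approx_move_pole:
  assumes a: "entire_approx B (\<lambda>z. 1 / (z - a))" and d: "d > 0" "\<And>z. z \<in> B \<Longrightarrow> d \<le> cmod (z - a)"
    and b: "cmod (b - a) \<le> q * d" "q < 1"
  shows "entire_approx B (\<lambda>z. 1 / (z - b))"
proof -
  have q: "cmod ((b - a) * (1 / (z - a))) \<le> q" if "z \<in> B" for z
  proof -
    have "0 \<le> q * d" using b(1) norm_ge_zero[of "b - a"] by linarith
    then have "q \<ge> 0" using d(1) by (simp add: zero_le_mult_iff)
    then have "cmod (b - a) \<le> q * cmod (z - a)"
      using b(1) mult_left_mono[OF d(2)[OF that], of q] by linarith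
    moreover have "0 < cmod (z - a)" using d(1) d(2)[OF that] by linarith
    ultimately show ?thesis by (simp add: norm_divide pos_divide_le_eq)
  qed
  have 1: "entire_approx B (\<lambda>z. 1 / (1 - (b - a) * (1 / (z - a))))"
    using entire_approx_geometric[OF entire_approx_cmult[OF a, of "b - a"] q b(2)] by simp
  have ba: "bounded ((\<lambda>z. 1 / (z - a)) ` B)"
    unfolding bounded_iff
  proof (intro exI ballI, safe)
    fix z assume "z \<in> B"
    then show "cmod (1 / (z - a)) \<le> 1 / d"
      using d(1) d(2)[of z] by (simp add: norm_divide frac_le)
  qed
  have bb: "bounded ((\<lambda>z. 1 / (1 - (b - a) * (1 / (z - a)))) ` B)"
    unfolding bounded_iff
  proof (intro exI ballI, safe)
    fix z assume z: "z \<in> B"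
    have "1 - q \<le> cmod (1 - (b - a) * (1 / (z - a)))"
      using q[OF z] norm_triangle_ineq2[of 1 "(b - a) * (1 / (z - a))"] by simp
    then show "cmod (1 / (1 - (b - a) * (1 / (z - a)))) \<le> 1 / (1 - q)"
      unfolding norm_divide norm_one using b(2) by (intro divide_left_mono mult_pos_pos) linarith+
  qed
  have "1 / (z - a) * (1 / (1 - (b - a) * (1 / (z - a)))) = 1 / (z - b)" if "z \<in> B" for z
  proof -
    have "z \<noteq> a" using d that by fastforce
    then have "(z - a) * (1 - (b - a) * (1 / (z - a))) = z - b" by (simp add: field_simps)
    then show ?thesis by (metis divide_divide_eq_left times_divide_times_eq mult_1)
  qed
  then show ?thesis
    using entire_approx_mult[OF a 1 ba bb] unfolding entire_approx_def by (simp cong: ball_cong)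
qed

text \<open>The geometric series in \<open>z / a\<close> has ratio at most 1/2 on
  \<open>B\<close>.\<close>

lemma entire_approx_far_pole:
  assumes "\<And>z. z \<in> B \<Longrightarrow> cmod z \<le> r" "2 * r < cmod a" "r > 0"
  shows "entire_approx B (\<lambda>z. 1 / (z - a))"
proof -
  have a: "a \<noteq> 0" using assms by auto
  have "entire_approx B (\<lambda>z. z / a)" using a by (intro entire_approx_entire holomorphic_intros) auto
  moreover have "cmod (z / a) \<le> 1 / 2" if "z \<in> B" for z
  proof -
    have "cmod z * 2 \<le> cmod a" using assms(1)[OF that] assms(2) by linarith
    then show ?thesis using a by (simp add: norm_divide field_simps)
  qed
  ultimately have "entire_approx B (\<lambda>z. 1 / (1 - z / a))" by (intro entire_approx_geometric[of _ _ "1/2"]) auto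
  then have "entire_approx B (\<lambda>z. (- 1 / a) * (1 / (1 - z / a)))" by (rule entire_approx_cmult)
  moreover have "(- 1 / a) * (1 / (1 - z / a)) = 1 / (z - a)" for z
  proof -
    have "a * (1 - z / a) = a - z" using a by (simp add: field_simps)
    then have "(- 1 / a) * (1 / (1 - z / a)) = - (1 / (a - z))" by simp
    then show ?thesis by (metis minus_diff_eq minus_divide_right)
  qed
  ultimately show ?thesis by simp
qed

text \<open>Runge's pole pushing: a far point of the unbounded \<open>S\<close> is an admissible
  pole, and admissibility is locally constant along \<open>S\<close>, so connectedness carries it to
  \<open>a\<close>.\<close>

lemma entire_approx_push_pole:
  assumes B: "compact B" and S: "connected S" "S \<inter> B = {}" "\<not> bounded S" and a: "a \<in> S"
  shows "entire_approx B (\<lambda>z. 1 / (z - a))"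
proof -
  obtain r where r: "r > 0" "\<And>z. z \<in> B \<Longrightarrow> cmod z \<le> r"
    using compact_imp_bounded[OF B] bounded_pos by metis
  obtain c where c: "c \<in> S" "2 * r < cmod c"
    using S(3) unfolding bounded_iff by (meson not_le)
  show ?thesis
  proof (rule connected_induction_simple[OF S(1), where P = "\<lambda>a. entire_approx B (\<lambda>z. 1 / (z - a))" and a = c])
    show "entire_approx B (\<lambda>z. 1 / (z - c))" using r c(2) by (intro entire_approx_far_pole) auto
    fix b assume b: "b \<in> S"
    obtain d where d: "d > 0" "\<And>z. z \<in> B \<Longrightarrow> d \<le> dist b z"
      using separate_point_closed[OF compact_imp_closed[OF B], of b] b S(2) by auto
    show "\<exists>T. openin (top_of_set S) T \<and> b \<in> T \<and>
      (\<forall>x\<in>T. \<forall>y\<in>T. entire_approx B (\<lambda>z. 1 / (z - x)) \<longrightarrow> entire_approx B (\<lambda>z. 1 / (z - y)))"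
    proof (intro exI conjI ballI impI)
      \<comment> \<open>Two points within \<open>d / 4\<close> of \<open>b\<close> are less than
        \<open>d / 2\<close> apart and at least \<open>3 * d / 4\<close> away from \<open>B\<close>;
        this gives the ratio 2/3 for moving the pole.\<close>
      show "openin (top_of_set S) (S \<inter> ball b (d/4))" by (simp add: openin_open_Int)
      show "b \<in> S \<inter> ball b (d/4)" using b d by auto
      fix x y assume x: "x \<in> S \<inter> ball b (d/4)" and y: "y \<in> S \<inter> ball b (d/4)"
        and ap: "entire_approx B (\<lambda>z. 1 / (z - x))"
      have "3 * d / 4 \<le> cmod (z - x)" if "z \<in> B" for z
        using d(2)[OF that] x dist_triangle[of b z x] by (simp add: dist_norm norm_minus_commute)
      moreover have "cmod (y - x) \<le> 2/3 * (3 * d / 4)"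
        using x y dist_triangle[of y x b] by (simp add: dist_norm norm_minus_commute)
      ultimately show "entire_approx B (\<lambda>z. 1 / (z - y))"
        using d(1) by (intro entire_approx_move_pole[OF ap, of "3*d/4" y "2/3"]) auto
    qed
  qed (use a c in auto)
qed

section \<open>The discrete Poisson integral\<close>

text \<open>The nodes of the discrete Poisson integral. For \<open>m = 0\<close> division by zero
  gives the value 1, so the modulus is 1 for every \<open>m\<close>.\<close>

definition root_pt :: "nat \<Rightarrow> nat \<Rightarrow> complex" where
  "root_pt m j = cis (2 * pi * real j / real m)"

text \<open>
  For \<open>|z| = |t| = 1\<close> this is the Poisson kernel at radius \<open>s\<close>, written so that it extends to a
  rational function of \<open>z\<close> with poles \<open>s t\<close> and \<open>t / s\<close> only.
\<close>

definition poisson_ker :: "real \<Rightarrow> complex \<Rightarrow> complex \<Rightarrow> complex" where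
  "poisson_ker s t z = 1 / (1 - of_real s * (z / t)) - 1 / (1 - (z / t) / of_real s)"

text \<open>\<open>c j\<close> is the value carried by the \<open>j\<close>-th node. It is a free
  sequence, since both samples of a function and points of a countable dense set are
  inserted.\<close>

definition poisson_sum :: "real \<Rightarrow> nat \<Rightarrow> (nat \<Rightarrow> complex) \<Rightarrow> complex \<Rightarrow> complex" where
  "poisson_sum s m c z = (\<Sum>j<m. c j * poisson_ker s (root_pt m j) z) / of_nat m"

lemma norm_root_pt [simp]: "cmod (root_pt m j) = 1"
  by (simp add: root_pt_def)

lemma root_pt_in_sphere [simp]: "root_pt m j \<in> sphere 0 1"
  by simp

lemma root_pt_power: "m > 0 \<Longrightarrow> root_pt m j ^ m = 1"
  using cis_multiple_2pi[of "real j"] unfolding root_pt_def by (simp add: Complex.DeMoivre)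

text \<open>A geometric sum whose ratio is an \<open>m\<close>-th root of unity, different from 1
  because \<open>m\<close> does not divide \<open>k\<close>.\<close>

lemma sum_root_pt_power:
  assumes "0 < k" "k < m"
  shows "(\<Sum>j<m. (1 / root_pt m j) ^ k) = 0"
proof -
  define w where "w = cis (- (2 * pi * real k / real m))"
  have "(1 / root_pt m j) ^ k = w ^ j" for j
    unfolding root_pt_def w_def by (simp add: Complex.DeMoivre divide_inverse algebra_simps)
  moreover have "w ^ m = 1"
  proof -
    have "w ^ m = cis (2 * pi * of_int (- int k))"
      unfolding w_def using assms by (simp add: Complex.DeMoivre)
    then show ?thesis using cis_multiple_2pi[of "of_int (- int k)"] by simp
  qed
  moreover have "w \<noteq> 1"
  proof
    assume "w = 1"
    then have "cos (2 * pi * real k / real m) = 1" by (simp add: w_def complex_eq_iff)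
    then obtain n :: int where "2 * pi * real k / real m = of_int n * 2 * pi"
      unfolding cos_one_2pi_int by blast
    then have "real k = of_int n * real m" using assms by (simp add: field_simps)
    then have "int k = n * int m" by (metis of_int_eq_iff of_int_mult of_int_of_nat_eq)
    then show False using assms by (metis dvd_triv_right int_dvd_int_iff nat_dvd_not_less)
  qed
  ultimately show ?thesis by (simp add: sum_gp_strict)
qed

text \<open>As the nodes have \<open>m\<close>-th power 1, each term is a finite geometric sum
  divided by \<open>1 - y ^ m\<close>; summing over the nodes leaves only the power
  \<open>k = 0\<close>.\<close>

lemma sum_resolvent_roots:
  assumes m: "m > 0" and y: "cmod y \<noteq> 1"
  shows "(\<Sum>j<m. 1 / (1 - y / root_pt m j)) / of_nat m = 1 / (1 - y ^ m)"
proof -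
  have ym: "y ^ m \<noteq> 1"
    using y m by (metis norm_one norm_power norm_ge_zero power_eq_1_iff less_not_refl)
  have "1 / (1 - y / root_pt m j) = (\<Sum>k<m. y ^ k * (1 / root_pt m j) ^ k) / (1 - y ^ m)" for j
  proof -
    have "y / root_pt m j \<noteq> 1" (is "?q \<noteq> 1") using y by (metis norm_divide norm_one norm_root_pt div_by_1)
    moreover have "(y / root_pt m j) ^ m = y ^ m" using m by (simp add: power_divide root_pt_power)
    ultimately have "(\<Sum>k<m. (y / root_pt m j) ^ k) = (1 - y ^ m) / (1 - y / root_pt m j)"
      using m by (simp add: sum_gp_strict)
    then show ?thesis using ym by (simp add: power_divide)
  qed
  then have "(\<Sum>j<m. 1 / (1 - y / root_pt m j)) = (\<Sum>j<m. \<Sum>k<m. y ^ k * (1 / root_pt m j) ^ k) / (1 - y ^ m)"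
    by (simp add: sum_divide_distrib)
  also have "(\<Sum>j<m. \<Sum>k<m. y ^ k * (1 / root_pt m j) ^ k) = (\<Sum>k<m. y ^ k * (\<Sum>j<m. (1 / root_pt m j) ^ k))"
    by (subst sum.swap) (simp add: sum_distrib_left)
  also have "\<dots> = (\<Sum>k<m. if k = 0 then of_nat m else 0)"
    using sum_root_pt_power by (intro sum.cong) auto
  also have "\<dots> = of_nat m" using m by simp
  finally show ?thesis using m by simp
qed

text \<open>Counterpart of the Poisson kernel having mean 1: the sum is exactly
  \<open>1 / (1 - (s z)^m) - 1 / (1 - (z / s)^m)\<close>, and its two terms are within
  \<open>s ^ m / (1 - s ^ m)\<close> of 1 and of 0.\<close>

lemma poisson_sum_one:
  assumes s: "0 < s" "s < 1" and z: "cmod z = 1" and m: "m > 0"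
  shows "cmod (poisson_sum s m (\<lambda>_. 1) z - 1) \<le> 2 * (s ^ m / (1 - s ^ m))"
proof -
  have "poisson_sum s m (\<lambda>_. 1) z
      = (\<Sum>j<m. 1 / (1 - (of_real s * z) / root_pt m j)) / of_nat m
        - (\<Sum>j<m. 1 / (1 - (z / of_real s) / root_pt m j)) / of_nat m"
    by (simp add: poisson_sum_def poisson_ker_def sum_subtractf diff_divide_distrib mult_ac)
  also have "\<dots> = 1 / (1 - (of_real s * z) ^ m) - 1 / (1 - (z / of_real s) ^ m)"
    using assms by (subst (1 2) sum_resolvent_roots) (auto simp: norm_mult norm_divide field_simps)
  finally have eq: "poisson_sum s m (\<lambda>_. 1) z = 1 / (1 - (of_real s * z) ^ m) - 1 / (1 - (z / of_real s) ^ m)" .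
  define q where "q = s ^ m"
  have q: "0 < q" "q < 1" using s m by (auto simp: q_def power_less_one_iff)
  have n1: "cmod ((of_real s * z) ^ m) = q" "cmod (z ^ m) = 1"
    using s z by (auto simp: norm_mult norm_power q_def)
  have ne: "(of_real s * z) ^ m \<noteq> 1" using n1 q by auto
  have "1 / (1 - (of_real s * z) ^ m) - 1 = (of_real s * z) ^ m / (1 - (of_real s * z) ^ m)"
    using ne by (simp add: field_simps)
  moreover have "1 - q \<le> cmod (1 - (of_real s * z) ^ m)"
    using norm_triangle_ineq2[of 1 "(of_real s * z) ^ m"] n1 by simp
  ultimately have A: "cmod (1 / (1 - (of_real s * z) ^ m) - 1) \<le> q / (1 - q)"
    using n1 q by (simp add: norm_divide frac_le)
  have "1 / (1 - (z / of_real s) ^ m) = of_real q / (of_real q - z ^ m)"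
  proof -
    have "z ^ m \<noteq> of_real q" using n1 q by (metis norm_of_real abs_of_pos less_irrefl)
    then show ?thesis using s by (simp add: q_def power_divide field_simps)
  qed
  moreover have "1 - q \<le> cmod (of_real q - z ^ m)"
    using norm_triangle_ineq2[of "z ^ m" "of_real q"] n1 q by (simp add: norm_minus_commute)
  ultimately have B: "cmod (1 / (1 - (z / of_real s) ^ m)) \<le> q / (1 - q)"
    using q by (simp add: norm_divide frac_le)
  have "cmod (1 / (1 - (of_real s * z) ^ m) - 1 - 1 / (1 - (z / of_real s) ^ m)) \<le> q / (1 - q) + q / (1 - q)"
    by (rule order_trans[OF norm_triangle_ineq4 add_mono[OF A B]])
  then show ?thesis unfolding eq q_def by (simp add: algebra_simps)
qed

text \<open>On the circle this is the classical quotient of \<open>1 - s\<^sup>2\<close> by the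
  squared modulus of \<open>1 - s x\<close>, where \<open>x = z / t\<close>.\<close>

lemma poisson_ker_nonneg:
  assumes s: "0 < s" "s < 1" and z: "cmod z = 1" and t: "cmod t = 1"
  obtains p where "poisson_ker s t z = of_real p" "p \<ge> 0"
proof
  define x where "x = z / t"
  have x: "cmod x = 1" using z t by (simp add: x_def norm_divide)
  then have xx: "x * cnj x = 1" using complex_norm_square[of x] by simp
  have n1: "1 - of_real s * x \<noteq> 0" "1 - x / of_real s \<noteq> 0"
  proof -
    have "cmod (of_real s * x) \<noteq> 1" "cmod (x / of_real s) \<noteq> 1"
      using x s by (auto simp: norm_mult norm_divide)
    then show "1 - of_real s * x \<noteq> 0" "1 - x / of_real s \<noteq> 0" by auto
  qed
  define D where "D = (1 - of_real s * x) * cnj (1 - of_real s * x)"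
  have Dn: "D = of_real ((cmod (1 - of_real s * x))\<^sup>2)"
    unfolding D_def by (metis complex_norm_square)
  have frac: "1 / a = b / c" if "a * b = c" "a \<noteq> 0" "c \<noteq> 0" for a b c :: complex
    using that by auto
  have cn: "cnj (1 - of_real s * x) \<noteq> 0" using n1(1) by (metis complex_cnj_zero_iff)
  \<comment> \<open>As \<open>cnj x\<close> is the inverse of \<open>x\<close>, this factor turns
    the second denominator into the conjugate of the first.\<close>
  have "(1 - x / of_real s) * (- of_real s * cnj x) = cnj (1 - of_real s * x)"
    using xx s by (simp add: field_simps)
  then have "1 / (1 - x / of_real s) = - of_real s * cnj x / cnj (1 - of_real s * x)"
    using frac n1(2) cn by blast
  moreover have "1 / (1 - of_real s * x) + of_real s * cnj x / cnj (1 - of_real s * x)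
      = (cnj (1 - of_real s * x) + of_real s * cnj x * (1 - of_real s * x)) / D"
    unfolding D_def using n1(1) cn
    by (subst add_frac_eq) (simp_all del: complex_cnj_diff complex_cnj_mult)
  moreover have "cnj (1 - of_real s * x) + of_real s * cnj x * (1 - of_real s * x) = of_real (1 - s\<^sup>2)"
    using xx by (simp add: algebra_simps power2_eq_square)
  ultimately have "poisson_ker s t z = of_real (1 - s\<^sup>2) / D"
    unfolding poisson_ker_def x_def[symmetric] by simp
  then show "poisson_ker s t z = of_real ((1 - s\<^sup>2) / (cmod (1 - of_real s * x))\<^sup>2)"
    by (simp add: Dn)
  show "(1 - s\<^sup>2) / (cmod (1 - of_real s * x))\<^sup>2 \<ge> 0"
    using s by (simp add: power_le_one)
qed

text \<open>With \<open>x = z / t\<close> the kernel has numerator \<open>x (1 - s\<^sup>2)\<close>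
  over the factors \<open>1 - s x\<close> and \<open>x - s\<close>, both of modulus at least
  \<open>d / 2\<close> because \<open>1 - s \<le> d / 4\<close>. The point \<open>z\<close> may lie
  off the circle.\<close>

lemma poisson_ker_far:
  assumes s: "0 < s" "s < 1" "1 - s \<le> d / 4" and d: "d > 0" "d \<le> cmod (z - t)"
    and t: "cmod t = 1" and z: "cmod z \<le> 2"
  shows "cmod (poisson_ker s t z) \<le> 16 * (1 - s) / d\<^sup>2"
proof -
  define x where "x = z / t"
  have t0: "t \<noteq> 0" using t by auto
  then have "x - 1 = (z - t) / t" by (simp add: x_def field_simps)
  then have x1: "d \<le> cmod (x - 1)" using d t by (simp add: norm_divide)
  have x2: "cmod x \<le> 2" using z t by (simp add: x_def norm_divide)
  have "x - 1 = of_real (1 - s) * x - (1 - of_real s * x)" by (simp add: algebra_simps)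
  then have "cmod (x - 1) \<le> cmod (of_real (1 - s) * x) + cmod (1 - of_real s * x)"
    by (metis norm_triangle_ineq4)
  also have "cmod (of_real (1 - s) * x) \<le> (1 - s) * 2"
    unfolding norm_mult norm_of_real using x2 s by (intro mult_mono) auto
  finally have "cmod (x - 1) \<le> (1 - s) * 2 + cmod (1 - of_real s * x)" by simp
  with x1 have "d \<le> (1 - s) * 2 + cmod (1 - of_real s * x)" by (rule order_trans)
  then have a: "d / 2 \<le> cmod (1 - of_real s * x)" using s(3) by (simp add: field_simps)
  have "x - 1 = (x - of_real s) - of_real (1 - s)" by simp
  then have "cmod (x - 1) \<le> cmod (x - of_real s) + (1 - s)"
    using s by (metis norm_triangle_ineq4 norm_of_real abs_of_nonneg diff_ge_0_iff_ge less_imp_le)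
  then have b: "d / 2 \<le> cmod (x - of_real s)" using x1 s d by linarith
  have ne: "1 - of_real s * x \<noteq> 0" "x - of_real s \<noteq> 0" using a b d by auto
  have "1 / (1 - x / of_real s) = - of_real s / (x - of_real s)"
  proof -
    have "of_real s * (1 - x / of_real s) = - (x - of_real s)" using s by (simp add: field_simps)
    then have "1 - x / of_real s = (x - of_real s) / - of_real s" using s by (simp add: field_simps)
    then show ?thesis by simp
  qed
  then have "poisson_ker s t z = 1 / (1 - of_real s * x) + of_real s / (x - of_real s)"
    unfolding poisson_ker_def x_def[symmetric] by simp
  also have "\<dots> = x * of_real (1 - s\<^sup>2) / ((1 - of_real s * x) * (x - of_real s))"
    using ne by (simp add: add_frac_eq) (simp add: algebra_simps power2_eq_square)
  finally have "cmod (poisson_ker s t z)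
      = cmod x * \<bar>1 - s\<^sup>2\<bar> / (cmod (1 - of_real s * x) * cmod (x - of_real s))"
    by (simp add: norm_mult norm_divide del: of_real_diff of_real_power)
  also have "\<dots> \<le> 2 * (2 * (1 - s)) / (d / 2 * (d / 2))"
  proof (intro frac_le mult_mono)
    have "1 - s\<^sup>2 = (1 - s) * (1 + s)" by (simp add: algebra_simps power2_eq_square)
    also have "\<dots> \<le> (1 - s) * 2" using s by (intro mult_left_mono) auto
    finally show "\<bar>1 - s\<^sup>2\<bar> \<le> 2 * (1 - s)" using s by (simp add: abs_le_iff power_le_one)
  qed (use a b d s x2 in auto)
  also have "\<dots> = 16 * (1 - s) / d\<^sup>2" by (simp add: power2_eq_square field_simps)
  finally show ?thesis .
qed

text \<open>Nodes with coefficient 0 drop out, so \<open>z\<close> may be close to them. The bound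
  is the same for every \<open>m\<close>.\<close>

lemma poisson_sum_far:
  assumes s: "0 < s" "s < 1" "1 - s \<le> d / 4" and d: "d > 0" and z: "cmod z \<le> 2"
    and c: "\<And>j. cmod (c j) \<le> M" and far: "\<And>j. c j \<noteq> 0 \<Longrightarrow> d \<le> cmod (z - root_pt m j)"
  shows "cmod (poisson_sum s m c z) \<le> M * (16 * (1 - s) / d\<^sup>2)"
proof -
  have M: "M \<ge> 0" using c[of 0] norm_ge_zero order_trans by blast
  have "cmod (c j * poisson_ker s (root_pt m j) z) \<le> M * (16 * (1 - s) / d\<^sup>2)" for j
  proof (cases "c j = 0")
    case False
    then show ?thesis unfolding norm_mult
      using poisson_ker_far[OF s d far norm_root_pt z, of j] c M by (intro mult_mono) auto
  qed (use M s in auto)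
  then have "cmod (\<Sum>j<m. c j * poisson_ker s (root_pt m j) z) \<le> real (card {..<m}) * (M * (16 * (1 - s) / d\<^sup>2))"
    by (intro sum_norm_bound) auto
  moreover have "0 \<le> M * (16 * (1 - s) / d\<^sup>2)" using M s by auto
  ultimately show ?thesis
    unfolding poisson_sum_def norm_divide
    by (cases "m = 0") (auto simp: pos_divide_le_eq mult_ac)
qed

text \<open>An approximate identity argument: near nodes are handled by uniform continuity and
  positivity of the kernel, far ones by its decay. The number of nodes is chosen after
  \<open>s\<close>, so that \<open>s ^ m\<close> is negligible.\<close>

lemma poisson_sum_approx:
  assumes \<psi>: "continuous_on (sphere 0 1) \<psi>" and e: "e > 0"
  shows "\<exists>s0<1. \<forall>s. s0 < s \<and> s < 1 \<longrightarrow>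
    (\<exists>m>0. \<forall>z\<in>sphere 0 1. cmod (poisson_sum s m (\<lambda>j. \<psi> (root_pt m j)) z - \<psi> z) < e)"
proof -
  obtain M where M: "M > 0" "\<And>z. z \<in> sphere 0 1 \<Longrightarrow> cmod (\<psi> z) \<le> M"
    using compact_imp_bounded[OF compact_continuous_image[OF \<psi> compact_sphere]]
    unfolding bounded_pos by auto
  have "uniformly_continuous_on (sphere 0 1) \<psi>"
    using compact_uniformly_continuous[OF \<psi> compact_sphere] .
  then obtain d where d: "d > 0"
    "\<And>x y. x \<in> sphere 0 1 \<Longrightarrow> y \<in> sphere 0 1 \<Longrightarrow> cmod (y - x) < d \<Longrightarrow> cmod (\<psi> y - \<psi> x) < e / 8"
    using e unfolding uniformly_continuous_on_def dist_norm by (metis divide_pos_pos zero_less_numeral)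
  \<comment> \<open>The bound 1/2 keeps \<open>s\<close> positive, \<open>d / 4\<close> is a
    condition of \<open>poisson_ker_far\<close>, and the last entry makes far nodes contribute at
    most \<open>e / 8\<close>.\<close>
  define \<eta> where "\<eta> = min (1 / 2) (min (d / 4) (e * d\<^sup>2 / (256 * M)))"
  have \<eta>: "\<eta> > 0" "\<eta> \<le> 1 / 2" "\<eta> \<le> d / 4" "\<eta> \<le> e * d\<^sup>2 / (256 * M)"
    using d e M by (auto simp: \<eta>_def)
  show ?thesis
  proof (intro exI[of _ "1 - \<eta>"] conjI allI impI)
    fix s assume "1 - \<eta> < s \<and> s < 1"
    then have s: "0 < s" "s < 1" "1 - s \<le> d / 4" "1 - s \<le> e * d\<^sup>2 / (256 * M)" using \<eta> by auto
    have far: "M * (32 * (1 - s) / d\<^sup>2) \<le> e / 8"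
      using s(4) M d by (simp add: field_simps)
    \<comment> \<open>\<open>\<kappa> \<le> 1\<close> gives \<open>T \<le> 2\<close>, and
      \<open>M * \<kappa> \<le> e / 4\<close> pays for replacing \<open>\<psi> z * T\<close> by
      \<open>\<psi> z\<close>.\<close>
    define \<kappa> where "\<kappa> = min 1 (e / (4 * M))"
    have \<kappa>: "\<kappa> > 0" "\<kappa> \<le> 1" "M * \<kappa> \<le> e / 4"
    proof -
      show "\<kappa> > 0" "\<kappa> \<le> 1" using e M by (auto simp: \<kappa>_def)
      have "\<kappa> \<le> e / (4 * M)" by (simp add: \<kappa>_def)
      then show "M * \<kappa> \<le> e / 4" using M by (simp add: field_simps)
    qed
    have "(\<lambda>m. s ^ m) \<longlonglongrightarrow> 0" using s by (intro LIMSEQ_power_zero) auto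
    then have "(\<lambda>m. 2 * (s ^ m / (1 - s ^ m))) \<longlonglongrightarrow> 2 * (0 / (1 - 0))"
      using s by (intro tendsto_intros) auto
    then have "\<forall>\<^sub>F m in sequentially. 2 * (s ^ m / (1 - s ^ m)) < \<kappa> \<and> m > 0"
      using \<kappa> by (intro eventually_conj order_tendstoD eventually_gt_at_top) auto
    then obtain m where m: "2 * (s ^ m / (1 - s ^ m)) < \<kappa>" "m > 0"
      using eventually_happens'[OF sequentially_bot] by blast
    show "\<exists>m>0. \<forall>z\<in>sphere 0 1. cmod (poisson_sum s m (\<lambda>j. \<psi> (root_pt m j)) z - \<psi> z) < e"
    proof (intro exI[of _ m] conjI ballI m(2))
      fix z :: complex assume z: "z \<in> sphere 0 1"
      let ?t = "root_pt m"
      have zn: "cmod z = 1" using z by simp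
      define p where "p j = Re (poisson_ker s (?t j) z)" for j
      have p: "poisson_ker s (?t j) z = of_real (p j)" "p j \<ge> 0" for j
        using poisson_ker_nonneg[OF s(1,2) zn norm_root_pt[of m j]] unfolding p_def by (metis Re_complex_of_real)+
      define T where "T = (\<Sum>j<m. p j) / real m"
      have T: "poisson_sum s m (\<lambda>_. 1) z = of_real T"
        unfolding poisson_sum_def T_def p by simp
      then have T1: "\<bar>T - 1\<bar> \<le> \<kappa>"
        using poisson_sum_one[OF s(1,2) zn m(2)] m(1)
        by (metis norm_of_real of_real_1 of_real_diff less_imp_le order_trans)
      have summand: "cmod ((\<psi> (?t j) - \<psi> z) * of_real (p j)) \<le> e / 8 * p j + M * (32 * (1 - s) / d\<^sup>2)" for j
      proof (cases "cmod (?t j - z) < d")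
        case True
        then have "cmod (\<psi> (?t j) - \<psi> z) \<le> e / 8" using d(2)[OF z, of "?t j"] by simp
        then have "cmod (\<psi> (?t j) - \<psi> z) * p j \<le> e / 8 * p j" using p by (intro mult_right_mono)
        moreover have "0 \<le> M * (32 * (1 - s) / d\<^sup>2)" using M s by simp
        ultimately show ?thesis using p(2)[of j] by (simp add: norm_mult)
      next
        case False
        then have "cmod (poisson_ker s (?t j) z) \<le> 16 * (1 - s) / d\<^sup>2"
          using s d zn by (intro poisson_ker_far) (auto simp: norm_minus_commute)
        then have "p j \<le> 16 * (1 - s) / d\<^sup>2" using p[of j] by simp
        moreover have "cmod (\<psi> (?t j) - \<psi> z) \<le> 2 * M"
          using norm_triangle_ineq4[of "\<psi> (?t j)" "\<psi> z"] M(2)[OF z] M(2)[of "?t j"] by simp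
        ultimately have "cmod (\<psi> (?t j) - \<psi> z) * p j \<le> 2 * M * (16 * (1 - s) / d\<^sup>2)"
          using p M by (intro mult_mono) auto
        moreover have "2 * M * (16 * (1 - s) / d\<^sup>2) = M * (32 * (1 - s) / d\<^sup>2)" by simp
        moreover have "0 \<le> e / 8 * p j" using e p by simp
        moreover have "cmod ((\<psi> (?t j) - \<psi> z) * of_real (p j)) = cmod (\<psi> (?t j) - \<psi> z) * p j"
          using p(2)[of j] by (simp add: norm_mult)
        ultimately show ?thesis by linarith
      qed
      have "poisson_sum s m (\<lambda>j. \<psi> (?t j)) z - \<psi> z * of_real T
          = (\<Sum>j<m. (\<psi> (?t j) - \<psi> z) * of_real (p j)) / of_nat m"
        unfolding poisson_sum_def p T_def
        by (simp add: left_diff_distrib sum_subtractf diff_divide_distrib sum_distrib_left)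
      also have "cmod \<dots> \<le> (\<Sum>j<m. e / 8 * p j + M * (32 * (1 - s) / d\<^sup>2)) / real m"
        unfolding norm_divide using summand by (simp add: divide_right_mono sum_norm_le)
      also have "\<dots> = e / 8 * T + M * (32 * (1 - s) / d\<^sup>2)"
        using m(2) by (simp add: sum.distrib T_def sum_distrib_left add_divide_distrib)
      also have "\<dots> \<le> e / 8 * 2 + e / 8"
        using far T1 \<kappa> e by (intro add_mono mult_left_mono) auto
      finally have 1: "cmod (poisson_sum s m (\<lambda>j. \<psi> (?t j)) z - \<psi> z * of_real T) \<le> e / 8 * 2 + e / 8" .
      have "\<psi> z * of_real T - \<psi> z = \<psi> z * of_real (T - 1)" by (simp add: algebra_simps)
      then have "cmod (\<psi> z * of_real T - \<psi> z) = cmod (\<psi> z) * \<bar>T - 1\<bar>" by (metis norm_mult norm_of_real)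
      also have "\<dots> \<le> M * \<kappa>" using M(2)[OF z] T1 M(1) by (intro mult_mono) auto
      finally have 2: "cmod (\<psi> z * of_real T - \<psi> z) \<le> e / 4" using \<kappa> by simp
      show "cmod (poisson_sum s m (\<lambda>j. \<psi> (?t j)) z - \<psi> z) < e"
        using norm_triangle_ineq[of "poisson_sum s m (\<lambda>j. \<psi> (?t j)) z - \<psi> z * of_real T" "\<psi> z * of_real T - \<psi> z"] 1 2 e by simp
    qed
  qed (use \<eta> in simp)
qed

section \<open>Pole pushing through a keyhole\<close>

text \<open>Since \<open>\<zeta> * cis \<theta>\<close> has squared distance
  \<open>2 - 2 * cos \<theta>\<close> from \<open>\<zeta>\<close>, the set is the image of one
  interval of angles symmetric about \<open>pi\<close>.\<close>

lemma connected_arc: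
  assumes \<zeta>: "cmod \<zeta> = 1" and d: "0 \<le> d" "d \<le> 2"
  shows "connected {t \<in> sphere 0 1. d \<le> cmod (t - \<zeta>)}"
proof -
  define c where "c = 1 - d\<^sup>2 / 2"
  have "d\<^sup>2 \<le> 2\<^sup>2" using d by (intro power_mono) auto
  then have c: "-1 \<le> c" "c \<le> 1" by (auto simp: c_def)
  define \<alpha> where "\<alpha> = arccos c"
  have \<alpha>: "0 \<le> \<alpha>" "\<alpha> \<le> pi" "cos \<alpha> = c"
    using c arccos_lbound arccos_ubound cos_arccos by (auto simp: \<alpha>_def)
  have dist: "d \<le> cmod (\<zeta> * cis \<theta> - \<zeta>) \<longleftrightarrow> cos \<theta> \<le> c" for \<theta>
  proof -
    have "\<zeta> * cis \<theta> - \<zeta> = \<zeta> * (cis \<theta> - 1)" by (simp add: algebra_simps)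
    then have "(cmod (\<zeta> * cis \<theta> - \<zeta>))\<^sup>2 = (cmod (cis \<theta> - 1))\<^sup>2"
      using \<zeta> by (simp add: norm_mult)
    also have "\<dots> = (cos \<theta> - 1)\<^sup>2 + (sin \<theta>)\<^sup>2" by (simp add: cmod_power2)
    also have "\<dots> = 2 - 2 * cos \<theta>" using sin_cos_squared_add[of \<theta>] by (simp add: power2_diff)
    finally have "(cmod (\<zeta> * cis \<theta> - \<zeta>))\<^sup>2 = 2 - 2 * cos \<theta>" .
    moreover have "d \<le> cmod (\<zeta> * cis \<theta> - \<zeta>) \<longleftrightarrow> d\<^sup>2 \<le> (cmod (\<zeta> * cis \<theta> - \<zeta>))\<^sup>2"
      using d(1) by (simp add: abs_le_square_iff[symmetric])
    ultimately show ?thesis by (auto simp: c_def field_simps)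
  qed
  have "{t \<in> sphere 0 1. d \<le> cmod (t - \<zeta>)} = (\<lambda>\<theta>. \<zeta> * cis \<theta>) ` {\<alpha>..2 * pi - \<alpha>}"
  proof (intro equalityI subsetI)
    fix t assume t: "t \<in> {t \<in> sphere 0 1. d \<le> cmod (t - \<zeta>)}"
    define \<theta> where "\<theta> = Arg2pi (t / \<zeta>)"
    have z0: "\<zeta> \<noteq> 0" using \<zeta> by auto
    have "cmod (t / \<zeta>) = 1" using t \<zeta> by (simp add: norm_divide)
    then have "t / \<zeta> = cis \<theta>" using Arg2pi_eq[of "t / \<zeta>"] by (simp add: \<theta>_def cis_conv_exp mult.commute)
    then have teq: "t = \<zeta> * cis \<theta>" using z0 by (simp add: field_simps)
    have \<theta>: "0 \<le> \<theta>" "\<theta> < 2 * pi" using Arg2pi[of "t / \<zeta>"] by (auto simp: \<theta>_def)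
    have cs: "cos \<theta> \<le> cos \<alpha>" using t teq dist \<alpha> by auto
    have "\<alpha> \<le> \<theta>"
      using cos_monotone_0_pi[of \<theta> \<alpha>] \<theta> \<alpha> cs by linarith
    moreover have "\<alpha> \<le> 2 * pi - \<theta>"
    proof (rule ccontr)
      assume "\<not> \<alpha> \<le> 2 * pi - \<theta>"
      then have "cos \<alpha> < cos (2 * pi - \<theta>)" using \<theta> \<alpha> by (intro cos_monotone_0_pi) auto
      then show False using cs by (simp add: cos_diff)
    qed
    ultimately show "t \<in> (\<lambda>\<theta>. \<zeta> * cis \<theta>) ` {\<alpha>..2 * pi - \<alpha>}" using teq by auto
  next
    fix t assume "t \<in> (\<lambda>\<theta>. \<zeta> * cis \<theta>) ` {\<alpha>..2 * pi - \<alpha>}"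
    then obtain \<theta> where \<theta>: "t = \<zeta> * cis \<theta>" "\<alpha> \<le> \<theta>" "\<theta> \<le> 2 * pi - \<alpha>"
      by (metis (no_types, lifting) atLeastAtMost_iff imageE)
    have "cos \<theta> \<le> cos \<alpha>"
    proof (cases "\<theta> \<le> pi")
      case True
      then show ?thesis using \<theta> \<alpha> by (intro cos_monotone_0_pi_le) auto
    next
      case False
      then have "cos (2 * pi - \<theta>) \<le> cos \<alpha>" using \<theta> \<alpha> by (intro cos_monotone_0_pi_le) auto
      then show ?thesis by (simp add: cos_diff)
    qed
    then show "t \<in> {t \<in> sphere 0 1. d \<le> cmod (t - \<zeta>)}"
      using \<zeta> \<theta>(1) dist[of \<theta>] \<alpha> by (simp add: norm_mult)
  qed
  moreover have "connected ((\<lambda>\<theta>. \<zeta> * cis \<theta>) ` {\<alpha>..2 * pi - \<alpha>})"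
    by (intro connected_continuous_image continuous_intros) auto
  ultimately show ?thesis by simp
qed

text \<open>For \<open>l \<le> 1\<close> the point is within \<open>d\<close> of \<open>t\<close>,
  hence farther than \<open>2 * d\<close> from \<open>\<zeta>\<close>. For \<open>l > 1\<close> the
  distance is at least both \<open>3 * d - (l - 1)\<close> and \<open>l - 1\<close>, hence at least
  \<open>3 * d / 2\<close>.\<close>

lemma ray_avoids_cball:
  fixes l :: real
  assumes "cmod t = 1" "cmod \<zeta> = 1" "3 * d \<le> cmod (t - \<zeta>)" "s \<le> l" "1 - s < d" "s \<le> 1"
  shows "d < cmod (of_real l * t - \<zeta>)"
proof -
  have "cmod (of_real l * t - t) = \<bar>l - 1\<bar>"
  proof -
    have "of_real l * t - t = of_real (l - 1) * t" by (simp add: algebra_simps)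
    then show ?thesis using assms(1) by (metis norm_mult norm_of_real mult.right_neutral)
  qed
  then have 1: "cmod (t - \<zeta>) - \<bar>l - 1\<bar> \<le> cmod (of_real l * t - \<zeta>)"
    using norm_triangle_ineq4[of "of_real l * t - \<zeta>" "of_real l * t - t"] by simp
  have "\<bar>l\<bar> - 1 \<le> cmod (of_real l * t - \<zeta>)"
    using norm_triangle_ineq2[of "of_real l * t" \<zeta>] assms by (simp add: norm_mult)
  then show ?thesis using 1 assms by linarith
qed

lemma connected_ray: "connected ((\<lambda>l. of_real l * t) ` {a::real..})" for t :: complex
  by (intro connected_continuous_image continuous_intros) auto

lemma unbounded_ray:
  assumes "(\<lambda>l. of_real l * t) ` {a::real..} \<subseteq> S" "cmod t = 1"
  shows "\<not> bounded S"
proof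
  assume "bounded S"
  then obtain M where M: "M > 0" "\<And>x. x \<in> S \<Longrightarrow> cmod x \<le> M" unfolding bounded_pos by blast
  have "of_real (max a (M + 1)) * t \<in> S" using assms(1) by (metis atLeast_iff image_subset_iff max.cobounded1)
  then have "\<bar>max a (M + 1)\<bar> \<le> M" using M(2) assms(2) by (metis norm_mult norm_of_real mult.right_neutral)
  then show False using M(1) by linarith
qed

text \<open>Each pole is joined to infinity off the keyhole set. Such a path may cross the unit
  circle only outside \<open>K\<close>: the inner pole uses the gap at \<open>\<eta>\<close>, the
  outer one already starts beyond the circle.\<close>

lemma entire_approx_keyhole_pole:
  assumes \<zeta>: "cmod \<zeta> = 1" and K: "compact K" "K \<subseteq> sphere 0 1" and \<eta>: "cmod \<eta> = 1" "\<eta> \<notin> K" "3 * d \<le> cmod (\<eta> - \<zeta>)"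
    and d: "0 < d" and s: "R < s" "0 < s" "s < 1" "1 - s < d"
    and t: "cmod t = 1" "3 * d \<le> cmod (t - \<zeta>)"
  shows "entire_approx (cball 0 R \<union> cball \<zeta> d \<union> K) (\<lambda>z. 1 / (z - of_real s * t))"
    and "entire_approx (cball 0 R \<union> cball \<zeta> d \<union> K) (\<lambda>z. 1 / (z - t / of_real s))"
proof -
  let ?B = "cball 0 R \<union> cball \<zeta> d \<union> K"
  let ?W = "{t \<in> sphere 0 1. 3 * d \<le> cmod (t - \<zeta>)}"
  have B: "compact ?B" using K by (intro compact_Un) auto
  have avoid: "of_real l * u \<notin> ?B"
    if "cmod u = 1" "3 * d \<le> cmod (u - \<zeta>)" "s \<le> l" "l = 1 \<Longrightarrow> u \<notin> K" for u l
  proof -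
    have l: "cmod (of_real l * u) = l" using that s by (simp add: norm_mult)
    have "of_real l * u \<notin> cball \<zeta> d"
      using ray_avoids_cball[OF that(1) \<zeta> that(2,3) s(4)] s by (simp add: dist_norm norm_minus_commute)
    moreover have "of_real l * u \<notin> cball 0 R" using l that s by simp
    moreover have "of_real l * u \<notin> K"
    proof
      assume k: "of_real l * u \<in> K"
      then have "l = 1" using K(2) l by auto
      then show False using k that by simp
    qed
    ultimately show ?thesis by simp
  qed
  have d2: "3 * d \<le> 2" using t \<zeta> norm_triangle_ineq4[of t \<zeta>] by simp
  \<comment> \<open>Poles on the circle of radius \<open>s\<close> move along it, away from \<open>\<zeta>\<close>, to \<open>s \<eta>\<close> and then out radially.\<close>
  let ?S = "(\<lambda>u. of_real s * u) ` ?W \<union> (\<lambda>l. of_real l * \<eta>) ` {s..}"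
  have "connected ((\<lambda>u. of_real s * u) ` ?W)"
    using d d2 by (intro connected_continuous_image continuous_intros connected_arc \<zeta>) auto
  moreover have "of_real s * \<eta> \<in> (\<lambda>u. of_real s * u) ` ?W \<inter> (\<lambda>l. of_real l * \<eta>) ` {s..}"
    using \<eta> by auto
  ultimately have "connected ?S" by (intro connected_Un connected_ray) auto
  moreover have "?S \<inter> ?B = {}" using avoid \<eta> s by fastforce
  moreover have "\<not> bounded ?S" by (rule unbounded_ray[of \<eta> s]) (use \<eta> in auto)
  ultimately show "entire_approx ?B (\<lambda>z. 1 / (z - of_real s * t))"
    by (rule entire_approx_push_pole[OF B]) (use t in auto)
  let ?S' = "(\<lambda>l. of_real l * t) ` {1 / s..}"
  have "1 < 1 / s" using s by simp
  then have l: "s \<le> l \<and> l \<noteq> 1" if "1 / s \<le> l" for l using that s by linarith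
  have "?S' \<inter> ?B = {}" using avoid[OF t] l by fastforce
  moreover have "\<not> bounded ?S'" by (rule unbounded_ray[OF subset_refl t(1)])
  moreover have "t / of_real s \<in> ?S'" by (rule image_eqI[of _ _ "1 / s"]) auto
  ultimately show "entire_approx ?B (\<lambda>z. 1 / (z - t / of_real s))"
    by (rule entire_approx_push_pole[OF B connected_ray])
qed

lemma poisson_ker_poles:
  assumes "s \<noteq> 0" "t \<noteq> 0"
  shows "poisson_ker s t z = (- (t / of_real s)) * (1 / (z - t / of_real s)) + (of_real s * t) * (1 / (z - of_real s * t))"
proof -
  have "1 - of_real s * (z / t) = (z - t / of_real s) / (- (t / of_real s))"
    using assms by (simp add: field_simps)
  moreover have "1 - (z / t) / of_real s = (z - of_real s * t) / (- (of_real s * t))"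
    using assms by (simp add: field_simps)
  ultimately show ?thesis unfolding poisson_ker_def by simp
qed

text \<open>The Poisson sum of the samples of \<open>\<psi>\<close> is already small on both discs
  and close to \<open>\<psi>\<close> on \<open>K\<close>. Its nodes with nonzero coefficient keep
  distance \<open>3 * d\<close> from \<open>\<zeta>\<close>, so its poles can be pushed out.\<close>

lemma entire_approx_keyhole:
  assumes \<zeta>: "cmod \<zeta> = 1" and K: "compact K" "K \<subseteq> sphere 0 1" and \<eta>: "cmod \<eta> = 1" "\<eta> \<notin> K" "3 * d \<le> cmod (\<eta> - \<zeta>)"
    and d: "0 < d" and R: "R < 1" and e: "e > 0"
    and \<psi>: "continuous_on (sphere 0 1) \<psi>" "\<And>t. t \<in> sphere 0 1 \<Longrightarrow> cmod (t - \<zeta>) < 3 * d \<Longrightarrow> \<psi> t = 0"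
  shows "\<exists>Q. Q holomorphic_on UNIV \<and> (\<forall>z\<in>cball 0 R \<union> cball \<zeta> d. cmod (Q z) < e)
    \<and> (\<forall>z\<in>K. cmod (Q z - \<psi> z) < e)"
proof -
  obtain M where M: "M > 0" "\<And>z. z \<in> sphere 0 1 \<Longrightarrow> cmod (\<psi> z) \<le> M"
    using compact_imp_bounded[OF compact_continuous_image[OF \<psi>(1) compact_sphere]]
    unfolding bounded_pos by auto
  obtain s0 where s0: "s0 < 1" "\<And>s. s0 < s \<Longrightarrow> s < 1 \<Longrightarrow>
    \<exists>m>0. \<forall>z\<in>sphere 0 1. cmod (poisson_sum s m (\<lambda>j. \<psi> (root_pt m j)) z - \<psi> z) < e / 2"
    using poisson_sum_approx[OF \<psi>(1), of "e / 2"] e by auto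
  \<comment> \<open>Nodes with nonzero coefficient are at least \<open>1 - R\<close> away from the
    first disc and \<open>2 * d\<close> from the second.\<close>
  define D where "D = min (1 - R) d"
  have D: "D > 0" "D \<le> 1 - R" "D \<le> d" using d R by (auto simp: D_def)
  \<comment> \<open>\<open>\<mu>\<close> becomes \<open>1 - s\<close>; halving the minimum makes the
    inequalities strict. The last entry brings the Poisson sum below \<open>e / 2\<close> on the
    discs.\<close>
  define \<mu> where "\<mu> = min (min (1 - s0) (1 - R)) (min (min 1 d) (min (D / 4) (e * D\<^sup>2 / (32 * M)))) / 2"
  have pos: "0 < e * D\<^sup>2 / (32 * M)" using e D M by simp
  have "0 < \<mu>" unfolding \<mu>_def using s0 R d D pos by simp
  moreover have "\<mu> < 1 - s0" "\<mu> < 1 - R" "\<mu> < 1" "\<mu> < d" "\<mu> < D / 4" "\<mu> < e * D\<^sup>2 / (32 * M)"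
    unfolding \<mu>_def using s0 R d D pos by (auto simp: min_def)
  moreover define s where "s = 1 - \<mu>"
  ultimately have s: "s0 < s" "R < s" "0 < s" "s < 1" "1 - s < d" "1 - s \<le> D / 4" "1 - s < e * D\<^sup>2 / (32 * M)"
    by auto
  obtain m where m: "m > 0"
    "\<And>z. z \<in> sphere 0 1 \<Longrightarrow> cmod (poisson_sum s m (\<lambda>j. \<psi> (root_pt m j)) z - \<psi> z) < e / 2"
    using s0(2)[OF s(1,4)] by auto
  define c where "c j = \<psi> (root_pt m j)" for j
  have supp: "3 * d \<le> cmod (root_pt m j - \<zeta>)" if "c j \<noteq> 0" for j
    using \<psi>(2)[OF root_pt_in_sphere] that unfolding c_def by force
  have d1: "d \<le> 1" using \<zeta> \<eta> norm_triangle_ineq4[of \<eta> \<zeta>] by simp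
  let ?B = "cball 0 R \<union> cball \<zeta> d \<union> K"
  have small: "cmod (poisson_sum s m c z) < e / 2" if z: "z \<in> cball 0 R \<union> cball \<zeta> d" for z
  proof -
    have "cmod z \<le> 2"
      using z R d1 \<zeta> norm_triangle_ineq2[of z \<zeta>] by (auto simp: dist_norm norm_minus_commute)
    moreover have "D \<le> cmod (z - root_pt m j)" if "c j \<noteq> 0" for j
      using z
    proof
      assume "z \<in> cball 0 R"
      then show ?thesis using norm_triangle_ineq2[of "root_pt m j" z] D by (simp add: norm_minus_commute)
    next
      assume "z \<in> cball \<zeta> d"
      then show ?thesis
        using norm_triangle_ineq4[of "root_pt m j - z" "\<zeta> - z"] supp[OF that] D d
        by (simp add: norm_minus_commute dist_norm)
    qed
    moreover have "cmod (c j) \<le> M" for j using M(2) by (simp add: c_def)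
    ultimately have "cmod (poisson_sum s m c z) \<le> M * (16 * (1 - s) / D\<^sup>2)"
      using s D by (intro poisson_sum_far) auto
    also have "\<dots> < e / 2" using s(7) M D by (simp add: field_simps)
    finally show ?thesis .
  qed
  have "entire_approx ?B (poisson_sum s m c)"
  proof -
    have term_approx: "entire_approx ?B (\<lambda>z. c j * poisson_ker s (root_pt m j) z)" for j
    proof (cases "c j = 0")
      case True
      then show ?thesis by (auto intro: entire_approx_entire)
    next
      case False
      have "root_pt m j \<noteq> 0" by (metis norm_root_pt norm_zero zero_neq_one)
      then have eq: "poisson_ker s (root_pt m j) z = (- (root_pt m j / of_real s)) * (1 / (z - root_pt m j / of_real s))
        + (of_real s * root_pt m j) * (1 / (z - of_real s * root_pt m j))" for z
        using s(3) by (intro poisson_ker_poles) auto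
      show ?thesis unfolding eq
        by (intro entire_approx_cmult entire_approx_add
            entire_approx_keyhole_pole[OF \<zeta> K \<eta> d s(2-5) norm_root_pt supp[OF False]])
    qed
    have "entire_approx ?B (\<lambda>z. (1 / of_nat m) * (\<Sum>j<m. c j * poisson_ker s (root_pt m j) z))"
      by (intro entire_approx_cmult entire_approx_sum term_approx)
    moreover have "(\<lambda>z. (1 / of_nat m) * (\<Sum>j<m. c j * poisson_ker s (root_pt m j) z)) = poisson_sum s m c"
      by (simp add: poisson_sum_def fun_eq_iff)
    ultimately show ?thesis by simp
  qed
  then obtain Q where Q: "Q holomorphic_on UNIV" "\<And>z. z \<in> ?B \<Longrightarrow> cmod (poisson_sum s m c z - Q z) < e / 2"
    unfolding entire_approx_def using e half_gt_zero by meson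
  have "cmod (Q z) < e" if "z \<in> cball 0 R \<union> cball \<zeta> d" for z
  proof -
    have "z \<in> ?B" using that by simp
    then show ?thesis
      using small[OF that] Q(2)[of z] norm_triangle_ineq2[of "Q z" "poisson_sum s m c z"]
        norm_minus_commute[of "Q z" "poisson_sum s m c z"] by linarith
  qed
  moreover have "cmod (Q z - \<psi> z) < e" if "z \<in> K" for z
    using norm_triangle_ineq[of "Q z - poisson_sum s m c z" "poisson_sum s m c z - \<psi> z"] Q(2)[of z] m(2)[of z] that K(2)
    unfolding c_def by (auto simp: norm_minus_commute)
  ultimately show ?thesis using Q(1) by blast
qed

section \<open>The inductive step\<close>

text \<open>The maximum of \<open>cmod\<close> over the compact set
  \<open>closure A - ball \<zeta> d\<close> is attained, and it is not 1, as \<open>\<zeta>\<close>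
  is the only point of \<open>closure A\<close> on the circle.\<close>

lemma away_from_limit_point_bounded:
  assumes "A \<subseteq> ball 0 1" "closure A \<inter> sphere 0 1 = {\<zeta>}" "d > 0"
  shows "\<exists>r<1. \<forall>z\<in>A. d \<le> cmod (z - \<zeta>) \<longrightarrow> cmod z \<le> r"
proof (cases "closure A - ball \<zeta> d = {}")
  case True
  then have "cmod (z - \<zeta>) < d" if "z \<in> A" for z
    using that closure_subset[of A] by (auto simp: dist_norm norm_minus_commute)
  then show ?thesis by (intro exI[of _ 0]) force
next
  case False
  have "bounded A" using assms(1) bounded_ball bounded_subset by blast
  then have "compact (closure A - ball \<zeta> d)" by (intro compact_diff) (auto simp: compact_closure)
  then obtain x where x: "x \<in> closure A - ball \<zeta> d" "\<And>z. z \<in> closure A - ball \<zeta> d \<Longrightarrow> cmod z \<le> cmod x"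
    using continuous_attains_sup[OF _ False continuous_on_norm_id] by blast
  have "closure A \<subseteq> cball 0 1" using closure_mono[OF assms(1)] by simp
  then have "cmod x \<le> 1" using x(1) by auto
  moreover have "cmod x \<noteq> 1"
  proof
    assume "cmod x = 1"
    then have "x \<in> closure A \<inter> sphere 0 1" using x(1) by simp
    then have "x = \<zeta>" unfolding assms(2) by simp
    then show False using x(1) assms(3) by simp
  qed
  ultimately have x1: "cmod x < 1" by simp
  have bd: "cmod z \<le> cmod x" if "z \<in> A" "d \<le> cmod (z - \<zeta>)" for z
    using that closure_subset[of A] by (intro x(2)) (auto simp: dist_norm norm_minus_commute)
  show ?thesis
    by (intro exI[of _ "cmod x"] conjI ballI impI x1) (rule bd)
qed

text \<open>Otherwise the circle would split into the disjoint closed sets \<open>K\<close> and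
  \<open>{\<zeta>}\<close>, against connectedness; \<open>K\<close> would be nonempty, since it
  would contain \<open>- \<zeta>\<close>.\<close>

lemma proper_compact_misses_other_point:
  assumes "compact K" "K \<subseteq> sphere 0 1" "K \<noteq> sphere 0 1" "cmod \<zeta> = 1"
  obtains \<eta> :: complex where "cmod \<eta> = 1" "\<eta> \<notin> K" "\<eta> \<noteq> \<zeta>"
proof (rule ccontr)
  assume "\<not> thesis"
  then have "cmod x = 1 \<Longrightarrow> x \<notin> K \<Longrightarrow> x = \<zeta>" for x using that by blast
  then have "sphere 0 1 \<subseteq> K \<union> {\<zeta>}" by auto
  moreover have "connected (sphere (0::complex) 1)" by (intro connected_sphere) simp
  moreover have "\<zeta> \<notin> K" using assms calculation by auto
  moreover have "K \<noteq> {}"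
  proof
    assume "K = {}"
    moreover have "-\<zeta> \<in> sphere 0 1" using assms(4) by simp
    ultimately have "-\<zeta> \<in> {\<zeta>}" using \<open>sphere 0 1 \<subseteq> K \<union> {\<zeta>}\<close> by blast
    then show False using assms(4) by auto
  qed
  ultimately have "K \<inter> sphere 0 1 = {} \<or> {\<zeta>} \<inter> sphere 0 1 = {}"
    using assms(1) by (intro connected_closedD) (auto simp: compact_imp_closed)
  then show False using assms(2,4) \<open>K \<noteq> {}\<close> by auto
qed

text \<open>The correction is \<open>P z = c * h z + Q (z / \<rho> n)\<close>: \<open>c * h\<close>
  supplies the missing value at \<open>\<zeta>\<close>, and the rescaling makes \<open>Q\<close>
  take its value at \<open>z\<close> itself when \<open>P\<close> is evaluated at
  \<open>\<rho> n * z\<close>. The bound on \<open>A\<close> does not involve \<open>R\<close>,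
  which \<open>growth_step\<close> exploits.\<close>

lemma approximation_step:
  assumes F: "F holomorphic_on UNIV" and \<phi>: "continuous_on (sphere 0 1) \<phi>"
    and K: "compact K" "K \<subseteq> sphere 0 1" "K \<noteq> sphere 0 1"
    and A: "A \<subseteq> ball 0 1" "closure A \<inter> sphere 0 1 = {\<zeta>}"
    and \<rho>: "\<And>n. \<rho> n < 1" "\<rho> \<longlonglongrightarrow> 1"
    and R: "0 \<le> R" "R < 1" and e: "e > 0"
  shows "\<exists>P n. N \<le> n \<and> P holomorphic_on UNIV \<and> (\<forall>z\<in>cball 0 R. cmod (P z) \<le> e)
    \<and> (\<forall>z\<in>K. cmod (F (of_real (\<rho> n) * z) + P (of_real (\<rho> n) * z) - \<phi> z) \<le> e)
    \<and> (\<forall>z\<in>A. cmod (P z) \<le> cmod (\<phi> \<zeta> - F \<zeta>) + e)"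
proof -
  have \<zeta>: "cmod \<zeta> = 1" using A(2) by auto
  obtain \<eta> where \<eta>: "cmod \<eta> = 1" "\<eta> \<notin> K" "\<eta> \<noteq> \<zeta>"
    using proper_compact_misses_other_point[OF K \<zeta>] .
  define c where "c = \<phi> \<zeta> - F \<zeta>"
  \<comment> \<open>On \<open>cball 0 R\<close> the base of the power \<open>h\<close> has modulus
    at most \<open>(1 + R) / 2 < 1\<close>, so a high power makes \<open>c * h\<close> small
    there.\<close>
  have "(\<lambda>N. ((1 + R) / 2) ^ N * cmod c) \<longlonglongrightarrow> 0 * cmod c"
    using R by (intro tendsto_intros LIMSEQ_power_zero) auto
  then have "\<forall>\<^sub>F N in sequentially. ((1 + R) / 2) ^ N * cmod c < e / 2"
    using e by (intro order_tendstoD) auto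
  then obtain k where k: "((1 + R) / 2) ^ k * cmod c < e / 2"
    using eventually_happens'[OF sequentially_bot] by blast
  define h where "h z = ((1 + cnj \<zeta> * z) / 2) ^ k" for z
  have h\<zeta>: "h \<zeta> = 1"
  proof -
    have "cnj \<zeta> * \<zeta> = 1" using \<zeta> complex_norm_square[of \<zeta>] by (simp add: mult.commute)
    then show ?thesis by (simp add: h_def)
  qed
  have hb: "cmod (h z) \<le> ((1 + r) / 2) ^ k" if "cmod z \<le> r" for z :: complex and r
  proof -
    have "cmod (1 + cnj \<zeta> * z) \<le> 1 + r"
      using norm_triangle_ineq[of 1 "cnj \<zeta> * z"] \<zeta> that by (simp add: norm_mult)
    then show ?thesis unfolding h_def norm_power norm_divide by (intro power_mono) auto
  qed
  define G where "G z = F z + c * h z" for z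
  have G: "continuous_on UNIV G" unfolding G_def h_def
    by (intro continuous_intros holomorphic_on_imp_continuous_on[OF F]) auto
  define g where "g t = \<phi> t - G t" for t
  have g: "continuous_on (sphere 0 1) g" unfolding g_def
    by (intro continuous_intros \<phi> continuous_on_subset[OF G]) auto
  have "g \<zeta> = 0" by (simp add: g_def G_def h\<zeta> c_def)
  then obtain \<delta> where \<delta>: "\<delta> > 0" "\<And>t. t \<in> sphere 0 1 \<Longrightarrow> cmod (t - \<zeta>) < \<delta> \<Longrightarrow> cmod (g t) < e / 8"
    using g \<zeta> e unfolding continuous_on_iff dist_norm
    by (metis diff_zero mem_sphere_0 zero_less_divide_iff zero_less_numeral)
  \<comment> \<open>\<open>4 * d \<le> \<delta>\<close> keeps \<open>g\<close> small where the
    cutoff \<open>u\<close> is below 1; \<open>3 * d \<le> cmod (\<eta> - \<zeta>)\<close> keeps the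
    gap point \<open>\<eta>\<close> clear of the disc about \<open>\<zeta>\<close>.\<close>
  define d where "d = min (\<delta> / 4) (cmod (\<eta> - \<zeta>) / 3)"
  have d: "d > 0" "4 * d \<le> \<delta>" "3 * d \<le> cmod (\<eta> - \<zeta>)"
    using \<delta> \<eta> by (auto simp: d_def)
  \<comment> \<open>A continuous cutoff: 0 within \<open>3 * d\<close> of \<open>\<zeta>\<close>, 1
    beyond \<open>4 * d\<close>.\<close>
  define u where "u t = max 0 (min 1 (cmod (t - \<zeta>) / d - 3))" for t
  have u: "0 \<le> u t" "u t \<le> 1" for t by (auto simp: u_def)
  define \<psi> where "\<psi> t = of_real (u t) * g t" for t
  have \<psi>: "continuous_on (sphere 0 1) \<psi>" unfolding \<psi>_def u_def
    using d by (intro continuous_intros g) auto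
  have \<psi>0: "\<psi> t = 0" if "cmod (t - \<zeta>) < 3 * d" for t
  proof -
    have "cmod (t - \<zeta>) / d < 3" using that d by (simp add: pos_divide_less_eq)
    then show ?thesis by (simp add: \<psi>_def u_def)
  qed
  have \<psi>g: "cmod (\<psi> t - g t) \<le> e / 8" if t: "t \<in> sphere 0 1" for t
  proof (cases "cmod (t - \<zeta>) < 4 * d")
    case True
    then have g8: "cmod (g t) \<le> e / 8" using \<delta>(2)[OF t] d by simp
    have "\<psi> t - g t = of_real (u t - 1) * g t" by (simp add: \<psi>_def algebra_simps)
    then have "cmod (\<psi> t - g t) = \<bar>u t - 1\<bar> * cmod (g t)" by (metis norm_mult norm_of_real)
    also have "\<dots> \<le> 1 * (e / 8)" using u[of t] g8 by (intro mult_mono) auto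
    finally show ?thesis by simp
  next
    case False
    then have "cmod (t - \<zeta>) / d \<ge> 4" using d by (simp add: pos_le_divide_eq)
    then show ?thesis using e by (simp add: \<psi>_def u_def)
  qed
  obtain r where r: "r < 1" "\<And>z. z \<in> A \<Longrightarrow> d / 2 \<le> cmod (z - \<zeta>) \<Longrightarrow> cmod z \<le> r"
    using away_from_limit_point_bounded[OF A, of "d / 2"] d(1) by auto
  define R1 where "R1 = max R r"
  define R2 where "R2 = (1 + R1) / 2"
  have R12: "0 \<le> R1" "R1 < 1" "R1 < R2" "R2 < 1" using R r(1) by (auto simp: R1_def R2_def)
  have R2: "0 < R2" using R12 by linarith
  obtain Q where Q: "Q holomorphic_on UNIV" "\<And>z. z \<in> cball 0 R2 \<union> cball \<zeta> d \<Longrightarrow> cmod (Q z) < e / 4"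
    "\<And>z. z \<in> K \<Longrightarrow> cmod (Q z - \<psi> z) < e / 4"
    using entire_approx_keyhole[OF \<zeta> K(1,2) \<eta>(1,2) d(3) d(1) R12(4) _ \<psi> \<psi>0, of "e / 4"] e by auto
  have "uniformly_continuous_on (cball 0 1) G"
    by (intro compact_uniformly_continuous continuous_on_subset[OF G]) auto
  then obtain \<delta>' where \<delta>': "\<delta>' > 0" "\<And>x y. x \<in> cball 0 1 \<Longrightarrow> y \<in> cball 0 1 \<Longrightarrow> cmod (y - x) < \<delta>' \<Longrightarrow> cmod (G y - G x) < e / 8"
    using e unfolding uniformly_continuous_on_def dist_norm by (metis divide_pos_pos zero_less_numeral)
  \<comment> \<open>The thresholds serve in turn: division by \<open>\<rho> n\<close> maps
    \<open>cball 0 R1\<close> into \<open>cball 0 R2\<close>, it moves points of the unit disc by at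
    most \<open>d / 2\<close>, the scale is positive, and \<open>G\<close> changes by less than
    \<open>e / 8\<close>.\<close>
  have "\<forall>\<^sub>F n in sequentially. max (R1 / R2) (max (1 / (1 + d / 2)) (max 0 (1 - \<delta>'))) < \<rho> n \<and> N \<le> n"
    using R12 R2 d \<delta>'(1) by (intro eventually_conj order_tendstoD(1)[OF \<rho>(2)] eventually_ge_at_top) auto
  then obtain n where n: "max (R1 / R2) (max (1 / (1 + d / 2)) (max 0 (1 - \<delta>'))) < \<rho> n" "N \<le> n"
    using eventually_happens'[OF sequentially_bot] by blast
  define x where "x = \<rho> n"
  have x: "R1 \<le> R2 * x" "1 \<le> (1 + d / 2) * x" "0 < x" "1 - \<delta>' < x" "x < 1"
    using n(1) R2 d \<rho>(1)[of n] by (auto simp: x_def field_simps)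
  have scale: "cmod (z / of_real x) \<le> R2" if "cmod z \<le> R1" for z :: complex
  proof -
    have "cmod z \<le> R2 * x" using that x(1) by linarith
    then show ?thesis using x(3) by (simp add: norm_divide pos_divide_le_eq)
  qed
  define P where "P z = c * h z + Q (z / of_real x)" for z
  show ?thesis
  proof (intro exI conjI ballI)
    show "N \<le> n" by fact
    have "(Q \<circ> (\<lambda>z. z / of_real x)) holomorphic_on UNIV"
      using x by (intro holomorphic_on_compose_gen[OF _ Q(1)] holomorphic_intros) auto
    then show "P holomorphic_on UNIV"
      unfolding P_def h_def o_def by (intro holomorphic_intros) auto
    fix z :: complex assume z: "z \<in> cball 0 R"
    then have "cmod (c * h z) \<le> e / 2"
      using mult_right_mono[OF hb[of z R], of "cmod c"] k by (simp add: norm_mult mult.commute)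
    moreover have "cmod (Q (z / of_real x)) < e / 4"
      using scale[of z] z by (intro Q(2)) (auto simp: R1_def)
    ultimately show "cmod (P z) \<le> e"
      unfolding P_def using norm_triangle_ineq[of "c * h z" "Q (z / of_real x)"] e by linarith
  next
    fix z assume z: "z \<in> K"
    then have z1: "cmod z = 1" using K(2) by auto
    have "of_real x * z - z = of_real (x - 1) * z" by (simp add: algebra_simps)
    then have "cmod (of_real x * z - z) = \<bar>x - 1\<bar>" using z1 by (metis norm_mult norm_of_real mult.right_neutral)
    then have "cmod (G (of_real x * z) - G z) < e / 8"
      using x z1 by (intro \<delta>'(2)) (auto simp: norm_mult)
    moreover have "cmod (Q z - \<psi> z) < e / 4" using Q(3)[OF z] .
    moreover have "cmod (\<psi> z - g z) \<le> e / 8" using \<psi>g z1 by simp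
    moreover have "F (of_real x * z) + P (of_real x * z) - \<phi> z
        = (G (of_real x * z) - G z) + ((Q z - \<psi> z) + (\<psi> z - g z))"
      using x(3) by (simp add: P_def G_def g_def)
    moreover have "cmod ((G (of_real x * z) - G z) + ((Q z - \<psi> z) + (\<psi> z - g z))) \<le> e / 8 + (e / 4 + e / 8)"
      using calculation(1-3) by (intro norm_triangle_mono) auto
    ultimately show "cmod (F (of_real (\<rho> n) * z) + P (of_real (\<rho> n) * z) - \<phi> z) \<le> e"
      using e unfolding x_def[symmetric] by simp
  next
    fix z assume z: "z \<in> A"
    then have z1: "cmod z \<le> 1" using A(1) by auto
    \<comment> \<open>Points of \<open>A\<close> at distance \<open>d / 2\<close> or more from
      \<open>\<zeta>\<close> lie in \<open>cball 0 R1\<close>; the others stay in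
      \<open>cball \<zeta> d\<close> after scaling.\<close>
    have "z / of_real x \<in> cball 0 R2 \<union> cball \<zeta> d"
    proof (cases "d / 2 \<le> cmod (z - \<zeta>)")
      case True
      then have "cmod z \<le> R1" using r(2)[OF z] by (simp add: R1_def)
      then show ?thesis using scale by simp
    next
      case False
      have "z / of_real x - z = of_real (1 / x - 1) * z" using x(3) by (simp add: field_simps)
      then have "cmod (z / of_real x - z) = \<bar>1 / x - 1\<bar> * cmod z" by (metis norm_mult norm_of_real)
      also have "\<dots> \<le> (d / 2) * 1"
      proof (intro mult_mono z1)
        have "1 / x \<le> 1 + d / 2" "1 \<le> 1 / x" using x(2,3,5) by (auto simp: pos_divide_le_eq)
        then show "\<bar>1 / x - 1\<bar> \<le> d / 2" by simp
      qed (use d in auto)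
      finally have "cmod (z / of_real x - \<zeta>) \<le> d"
        using False norm_triangle_ineq[of "z / of_real x - z" "z - \<zeta>"] by simp
      then show ?thesis by (simp add: dist_norm norm_minus_commute)
    qed
    then have "cmod (Q (z / of_real x)) < e / 4" by (rule Q(2))
    moreover have "cmod (c * h z) \<le> cmod c"
      using hb[of z 1] z1 by (simp add: norm_mult mult_left_le)
    ultimately show "cmod (P z) \<le> cmod (\<phi> \<zeta> - F \<zeta>) + e"
      unfolding P_def c_def[symmetric]
      using norm_triangle_ineq[of "c * h z" "Q (z / of_real x)"] e by linarith
  qed
qed

section \<open>Countable families of targets and of compact sets\<close>

lemma poisson_ker_bound:
  assumes s: "0 < s" "s < 1" and t: "cmod t = 1" and z: "cmod z = 1"
  shows "cmod (poisson_ker s t z) \<le> 2 / (1 - s)"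
    and "1 - of_real s * (z / t) \<noteq> 0" "1 - (z / t) / of_real s \<noteq> 0"
proof -
  define x where "x = z / t"
  have x: "cmod x = 1" using z t by (simp add: x_def norm_divide)
  have a: "1 - s \<le> cmod (1 - of_real s * x)"
    using norm_triangle_ineq2[of 1 "of_real s * x"] x s by (simp add: norm_mult)
  have "1 - s \<le> (1 - s) / s" using s by (simp add: pos_le_divide_eq mult_left_le)
  also have "\<dots> = 1 / s - 1" using s by (simp add: field_simps)
  also have "\<dots> \<le> cmod (1 - x / of_real s)"
    using norm_triangle_ineq2[of "x / of_real s" 1] x s by (simp add: norm_divide norm_minus_commute)
  finally have b: "1 - s \<le> cmod (1 - x / of_real s)" .
  have "cmod (poisson_ker s t z) \<le> cmod (1 / (1 - of_real s * x)) + cmod (1 / (1 - x / of_real s))"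
    unfolding poisson_ker_def x_def by (rule norm_triangle_ineq4)
  also have "\<dots> \<le> 1 / (1 - s) + 1 / (1 - s)"
    unfolding norm_divide norm_one using a b s by (intro add_mono frac_le) auto
  finally show "cmod (poisson_ker s t z) \<le> 2 / (1 - s)" by simp
  show "1 - of_real s * (z / t) \<noteq> 0" "1 - (z / t) / of_real s \<noteq> 0"
    using a b s by (auto simp: x_def)
qed

lemma continuous_on_poisson_sum:
  assumes s: "0 < s" "s < 1"
  shows "continuous_on (sphere 0 1) (poisson_sum s m c)"
proof -
  have "root_pt m j \<noteq> 0" for j by (metis norm_root_pt norm_zero zero_neq_one)
  then have "continuous_on (sphere 0 1) (poisson_ker s (root_pt m j))" for j
    unfolding poisson_ker_def
    using s poisson_ker_bound(2,3)[OF s norm_root_pt]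
    by (intro continuous_intros) (auto simp del: right_minus_eq)
  then show ?thesis unfolding poisson_sum_def
    by (cases "m = 0") (auto intro!: continuous_intros)
qed

text \<open>The family consists of Poisson sums with radii tending to 1 and coefficients in a
  countable dense set, each coded by a number and a list of indices.\<close>

lemma countable_dense_continuous_sphere:
  "\<exists>D :: (complex \<Rightarrow> complex) set. countable D \<and> (\<forall>\<psi>\<in>D. continuous_on (sphere 0 1) \<psi>) \<and>
    (\<forall>\<phi> e. continuous_on (sphere 0 1) \<phi> \<longrightarrow> e > 0 \<longrightarrow>
      (\<exists>\<psi>\<in>D. \<forall>z\<in>sphere 0 1. cmod (\<psi> z - \<phi> z) < e))"
proof -
  obtain C :: "complex set" where C: "countable C" "\<And>X. open X \<Longrightarrow> X \<noteq> {} \<Longrightarrow> \<exists>d\<in>C. d \<in> X"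
    using countable_dense_setE by blast
  define h where "h = (\<lambda>(k::nat, q::nat list).
    poisson_sum (1 - 1 / (real k + 2)) (length q) (\<lambda>j. from_nat_into C (q ! j)))"
  have rad: "0 < 1 - 1 / (real k + 2)" "1 - 1 / (real k + 2) < 1" for k by auto
  show ?thesis
  proof (intro exI[of _ "range h"] conjI ballI allI impI)
    show "countable (range h)" by simp
    show "continuous_on (sphere 0 1) \<psi>" if "\<psi> \<in> range h" for \<psi>
      using that continuous_on_poisson_sum[OF rad] by (auto simp: h_def)
    fix \<phi> :: "complex \<Rightarrow> complex" and e :: real
    assume \<phi>: "continuous_on (sphere 0 1) \<phi>" and e: "e > 0"
    obtain s0 where s0: "s0 < 1" "\<And>s. s0 < s \<Longrightarrow> s < 1 \<Longrightarrow>
      \<exists>m>0. \<forall>z\<in>sphere 0 1. cmod (poisson_sum s m (\<lambda>j. \<phi> (root_pt m j)) z - \<phi> z) < e / 2"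
      using poisson_sum_approx[OF \<phi>, of "e / 2"] e by auto
    obtain k where k: "inverse (real (Suc k)) < 1 - s0"
      using reals_Archimedean[of "1 - s0"] s0(1) by auto
    define s where "s = 1 - 1 / (real k + 2)"
    have s: "0 < s" "s < 1" using rad by (auto simp: s_def)
    have "1 / (real k + 2) \<le> inverse (real (Suc k))" by (simp add: field_simps)
    then have "s0 < s" using k by (simp add: s_def)
    then obtain m where m: "m > 0"
      "\<And>z. z \<in> sphere 0 1 \<Longrightarrow> cmod (poisson_sum s m (\<lambda>j. \<phi> (root_pt m j)) z - \<phi> z) < e / 2"
      using s0(2) s by blast
    \<comment> \<open>By \<open>poisson_ker_bound\<close>, moving the coefficients by
      \<open>\<kappa>\<close> moves the sum by at most
      \<open>2 * \<kappa> / (1 - s) = e / 2\<close>.\<close>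
    define \<kappa> where "\<kappa> = e * (1 - s) / 4"
    have \<kappa>: "\<kappa> > 0" using e s by (simp add: \<kappa>_def)
    have "\<exists>i. cmod (from_nat_into C i - \<phi> (root_pt m j)) < \<kappa>" for j
    proof -
      obtain d where "d \<in> C" "d \<in> ball (\<phi> (root_pt m j)) \<kappa>" using C(2)[of "ball (\<phi> (root_pt m j)) \<kappa>"] \<kappa> by auto
      then show ?thesis using from_nat_into_surj[OF C(1)] by (metis dist_norm mem_ball norm_minus_commute)
    qed
    then obtain i where i: "\<And>j. cmod (from_nat_into C (i j) - \<phi> (root_pt m j)) < \<kappa>" by metis
    define q where "q = map i [0..<m]"
    show "\<exists>\<psi>\<in>range h. \<forall>z\<in>sphere 0 1. cmod (\<psi> z - \<phi> z) < e"
    proof (intro bexI ballI)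
      show "h (k, q) \<in> range h" by simp
      fix z :: complex assume z: "z \<in> sphere 0 1"
      have hk: "h (k, q) z = (\<Sum>j<m. from_nat_into C (i j) * poisson_ker s (root_pt m j) z) / of_nat m"
        by (simp add: h_def q_def poisson_sum_def s_def)
      have "h (k, q) z - poisson_sum s m (\<lambda>j. \<phi> (root_pt m j)) z
        = (\<Sum>j<m. (from_nat_into C (i j) - \<phi> (root_pt m j)) * poisson_ker s (root_pt m j) z) / of_nat m"
        unfolding hk poisson_sum_def by (simp add: left_diff_distrib sum_subtractf diff_divide_distrib)
      also have "cmod \<dots> \<le> (real (card {..<m}) * (\<kappa> * (2 / (1 - s)))) / real m"
        unfolding norm_divide norm_of_nat
      proof (intro divide_right_mono sum_norm_bound)
        fix j
        show "cmod ((from_nat_into C (i j) - \<phi> (root_pt m j)) * poisson_ker s (root_pt m j) z) \<le> \<kappa> * (2 / (1 - s))"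
          unfolding norm_mult using i[of j] poisson_ker_bound(1)[OF s norm_root_pt] z \<kappa>
          by (intro mult_mono) auto
      qed auto
      also have "\<dots> = e / 2" using m(1) s by (simp add: \<kappa>_def field_simps)
      finally show "cmod (h (k, q) z - \<phi> z) < e"
        using m(2)[OF z] norm_triangle_ineq[of "h (k, q) z - poisson_sum s m (\<lambda>j. \<phi> (root_pt m j)) z"
            "poisson_sum s m (\<lambda>j. \<phi> (root_pt m j)) z - \<phi> z"] by simp
    qed
  qed
qed

text \<open>The family consists of the circle minus basic open sets that meet it: a proper compact
  \<open>K\<close> misses some point together with a basic neighbourhood.\<close>

lemma countable_exhausting_proper_compacts:
  "\<exists>\<K> :: complex set set. countable \<K> \<and>
    (\<forall>K\<in>\<K>. compact K \<and> K \<subseteq> sphere 0 1 \<and> K \<noteq> sphere 0 1) \<and>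
    (\<forall>K. compact K \<longrightarrow> K \<subseteq> sphere 0 1 \<longrightarrow> K \<noteq> sphere 0 1 \<longrightarrow> (\<exists>K'\<in>\<K>. K \<subseteq> K'))"
proof -
  obtain \<B> :: "complex set set" where \<B>: "countable \<B>" "topological_basis \<B>"
    using ex_countable_basis by blast
  define \<K> where "\<K> = (\<lambda>U. sphere 0 1 - U) ` {U \<in> \<B>. U \<inter> sphere 0 1 \<noteq> {}}"
  show ?thesis
  proof (intro exI[of _ \<K>] conjI ballI allI impI)
    show "countable \<K>" using \<B>(1) by (simp add: \<K>_def)
    show "compact K" "K \<subseteq> sphere 0 1" "K \<noteq> sphere 0 1" if "K \<in> \<K>" for K
      using that topological_basis_open[OF \<B>(2)] by (auto simp: \<K>_def intro!: compact_diff)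
  next
    fix K :: "complex set" assume K: "compact K" "K \<subseteq> sphere 0 1" "K \<noteq> sphere 0 1"
    then obtain p where p: "p \<in> sphere 0 1" "p \<in> - K" by blast
    moreover have "open (- K)" using K(1) by (simp add: compact_imp_closed open_Compl)
    ultimately obtain U where U: "U \<in> \<B>" "p \<in> U" "U \<subseteq> - K"
      using topological_basisE[OF \<B>(2)] by metis
    have "sphere 0 1 - U \<in> \<K>" unfolding \<K>_def using U p by blast
    moreover have "K \<subseteq> sphere 0 1 - U" using K(2) U(3) by blast
    ultimately show "\<exists>K'\<in>\<K>. K \<subseteq> K'" by blast
  qed
qed

section \<open>Limits, growth and subsequences\<close>

text \<open>A telescoping geometric sum. Increments are controlled only from \<open>k\<close> on,
  because a given point lies in the discs of small correction only from some stage onward.\<close>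

lemma lim_of_halving_increments:
  fixes a :: "nat \<Rightarrow> complex"
  assumes "\<And>j. k \<le> j \<Longrightarrow> cmod (a (Suc j) - a j) \<le> (1/2) ^ Suc j"
  shows "k \<le> j \<Longrightarrow> cmod (lim a - a j) \<le> (1/2) ^ j"
proof -
  have inc: "cmod (a (j + i) - a j) \<le> (1/2) ^ j - (1/2) ^ (j + i)" if "k \<le> j" for i j
  proof (induction i)
    case (Suc i)
    have "cmod (a (Suc (j + i)) - a (j + i)) \<le> (1/2) ^ Suc (j + i)" using that by (intro assms) auto
    then show ?case
      using Suc norm_triangle_ineq[of "a (Suc (j + i)) - a (j + i)" "a (j + i) - a j"] by simp
  qed simp
  have inc': "cmod (a i - a j) \<le> (1/2) ^ j" if "k \<le> j" "j \<le> i" for i j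
  proof -
    have "0 \<le> (1/2::real) ^ i" by simp
    moreover have "cmod (a i - a j) \<le> (1/2) ^ j - (1/2) ^ i" using inc[OF that(1), of "i - j"] that(2) by simp
    ultimately show ?thesis by linarith
  qed
  have "Cauchy a"
  proof (rule CauchyI)
    fix e :: real assume "e > 0"
    then obtain N where N: "(1/2::real) ^ N < e / 2"
      using real_arch_pow_inv[of "e / 2" "1/2"] by auto
    define M where "M = max N k"
    have "(1/2::real) ^ M \<le> (1/2) ^ N" by (intro power_decreasing) (auto simp: M_def)
    then have M: "(1/2::real) ^ M < e / 2" using N by linarith
    show "\<exists>M. \<forall>m\<ge>M. \<forall>n\<ge>M. cmod (a m - a n) < e"
    proof (intro exI allI impI)
      fix m n assume "M \<le> m" "M \<le> n"
      then have "cmod (a m - a M) \<le> (1/2) ^ M" "cmod (a n - a M) \<le> (1/2) ^ M"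
        by (auto intro!: inc' simp: M_def)
      then show "cmod (a m - a n) < e"
        using M norm_triangle_ineq4[of "a m - a M" "a n - a M"] by simp
    qed
  qed
  then have "a \<longlonglongrightarrow> lim a" by (simp add: Cauchy_convergent_iff convergent_LIMSEQ_iff)
  then show "cmod (lim a - a j) \<le> (1/2) ^ j" if "k \<le> j"
    using inc'[OF that]
    by (intro LIMSEQ_le_const2[of "\<lambda>i. cmod (a i - a j)"] tendsto_intros) auto
qed

text \<open>The bound for the correction on \<open>A\<close> is known before \<open>R'\<close> is
  chosen, so \<open>R'\<close> can be taken where \<open>w\<close> already exceeds it. The spare 1
  is left for all later corrections.\<close>

lemma growth_step:
  assumes F: "F holomorphic_on UNIV" and \<phi>: "continuous_on (sphere 0 1) \<phi>"
    and K: "compact K" "K \<subseteq> sphere 0 1" "K \<noteq> sphere 0 1"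
    and A: "A \<subseteq> ball 0 1" "closure A \<inter> sphere 0 1 = {\<zeta>}"
    and \<rho>: "\<And>n. \<rho> n < 1" "\<rho> \<longlonglongrightarrow> 1"
    and w: "filterlim w at_top (at_left 1)"
    and R: "0 \<le> R" "R < 1" and e: "0 < e" "e \<le> 1"
  shows "\<exists>G n R'. G holomorphic_on UNIV \<and> R \<le> R' \<and> R' < 1 \<and> N \<le> n
    \<and> (\<forall>z\<in>cball 0 R'. cmod (G z - F z) \<le> e)
    \<and> (\<forall>z\<in>K. cmod (dilate G (\<rho> n) z - \<phi> z) \<le> e)
    \<and> (\<forall>z\<in>A. R' \<le> cmod z \<longrightarrow> cmod (G z) + 1 \<le> w (cmod z))"
proof -
  have "compact (F ` cball 0 1)"
    using F by (intro compact_continuous_image holomorphic_on_imp_continuous_on) (auto intro: holomorphic_on_subset)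
  then have "bounded (F ` cball 0 1)" by (rule compact_imp_bounded)
  then obtain M where M: "\<forall>y\<in>F ` cball 0 1. cmod y \<le> M"
    unfolding bounded_iff ..
  \<comment> \<open>\<open>M\<close> bounds \<open>F\<close>, the second term and
    \<open>e \<le> 1\<close> bound \<open>P\<close> on \<open>A\<close>, and the remaining unit is
    the slack in the growth estimate.\<close>
  have "\<forall>\<^sub>F x in at_left 1. M + cmod (\<phi> \<zeta> - F \<zeta>) + 2 \<le> w x"
    using w by (simp add: filterlim_at_top)
  then obtain r where r: "r < 1" "\<And>x. r < x \<Longrightarrow> x < 1 \<Longrightarrow> M + cmod (\<phi> \<zeta> - F \<zeta>) + 2 \<le> w x"
    unfolding eventually_at_left_field by auto
  define R' where "R' = max R ((1 + r) / 2)"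
  have R': "0 \<le> R'" "R \<le> R'" "R' < 1" "r < R'" using R r(1) by (auto simp: R'_def less_max_iff_disj)
  obtain P n where P: "N \<le> n" "P holomorphic_on UNIV" "\<forall>z\<in>cball 0 R'. cmod (P z) \<le> e"
    "\<forall>z\<in>K. cmod (F (of_real (\<rho> n) * z) + P (of_real (\<rho> n) * z) - \<phi> z) \<le> e"
    "\<forall>z\<in>A. cmod (P z) \<le> cmod (\<phi> \<zeta> - F \<zeta>) + e"
    using approximation_step[where N = N, OF F \<phi> K A \<rho> R'(1,3) e(1)]
    by (elim exE conjE) (rule that, assumption+)
  have hol: "(\<lambda>z. F z + P z) holomorphic_on UNIV" using F P(2) by (rule holomorphic_on_add)
  have growth: "cmod (F z + P z) + 1 \<le> w (cmod z)" if z: "z \<in> A" "R' \<le> cmod z" for z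
  proof -
    have "cmod z < 1" using A(1) z(1) by auto
    then have "M + cmod (\<phi> \<zeta> - F \<zeta>) + 2 \<le> w (cmod z)" "cmod (F z) \<le> M"
      using r(2) R'(4) z(2) bspec[OF M imageI[of z]] by auto
    then show ?thesis
      using bspec[OF P(5) z(1)] e norm_triangle_ineq[of "F z" "P z"] by linarith
  qed
  have near: "cmod (F z + P z - F z) \<le> e" if "z \<in> cball 0 R'" for z
    using bspec[OF P(3) that] by simp
  have target: "cmod (dilate (\<lambda>z. F z + P z) (\<rho> n) z - \<phi> z) \<le> e" if "z \<in> K" for z
    using bspec[OF P(4) that] by (simp add: dilate_def)
  show ?thesis
    by (rule exI[of _ "\<lambda>z. F z + P z"], rule exI[of _ n], rule exI[of _ R'])
      (intro conjI ballI impI hol R'(2,3) P(1) near target growth; assumption)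
qed

text \<open>Arbitrarily late \<open>n\<close> are available for each tolerance, so the indices can
  be chosen strictly increasing with error below \<open>1 / real (Suc k)\<close>.\<close>

lemma subsequence_from_frequent_approximation:
  fixes g :: "nat \<Rightarrow> 'a \<Rightarrow> 'b :: metric_space"
  assumes "\<And>N e. e > 0 \<Longrightarrow> \<exists>n\<ge>N. \<forall>z\<in>K. dist (g n z) (\<phi> z) < e"
  shows "\<exists>n. strict_mono n \<and> uniform_limit K (\<lambda>k::nat. g (n k)) \<phi> sequentially"
proof -
  have "\<exists>n. \<forall>k. (\<forall>z\<in>K. dist (g (n k) z) (\<phi> z) < 1 / real (Suc k)) \<and> n k < n (Suc k)"
  proof (rule dependent_nat_choice)
    show "\<exists>n. \<forall>z\<in>K. dist (g n z) (\<phi> z) < 1 / real (Suc 0)" using assms[of 1] by auto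
    show "\<exists>y::nat. (\<forall>z\<in>K. dist (g y z) (\<phi> z) < 1 / real (Suc (Suc k))) \<and> x < y" for x k :: nat
      using assms[of "1 / real (Suc (Suc k))" "Suc x"] by (auto simp: Suc_le_eq)
  qed
  then obtain n where n: "\<And>k z. z \<in> K \<Longrightarrow> dist (g (n k) z) (\<phi> z) < 1 / real (Suc k)" "strict_mono n"
    using strict_mono_Suc_iff by metis
  have "uniform_limit K (\<lambda>k. g (n k)) \<phi> sequentially"
  proof (rule uniform_limitI)
    fix e :: real assume "e > 0"
    then obtain N where N: "1 / real (Suc N) < e"
      using reals_Archimedean[of e] by (auto simp: inverse_eq_divide)
    show "\<forall>\<^sub>F k in sequentially. \<forall>z\<in>K. dist (g (n k) z) (\<phi> z) < e"
      using eventually_ge_at_top[of N]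
    proof eventually_elim
      case (elim k)
      then have "1 / real (Suc k) \<le> 1 / real (Suc N)" by (intro frac_le) auto
      then show ?case using n(1)[of _ k] N by (meson less_le_trans less_trans order_le_less_trans)
    qed
  qed
  then show ?thesis using n(2) by blast
qed

section \<open>The universal function\<close>

theorem theorem3p9:
  fixes \<rho> :: "nat \<Rightarrow> real" and w :: "real \<Rightarrow> real" and A :: "complex set"
  assumes "\<forall>n. 0 \<le> \<rho> n \<and> \<rho> n < 1" and "incseq \<rho>" and "\<rho> \<longlonglongrightarrow> 1"
    and "continuous_on {0..<1} w" and "mono_on {0..<1} w" and "\<forall>r\<in>{0..<1}. 1 \<le> w r"
    and "filterlim w at_top (at_left 1)"
    and "A \<subseteq> ball 0 1" and "\<exists>\<zeta>. closure A \<inter> sphere 0 1 = {\<zeta>}"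
  shows "\<exists>f\<in>U_A \<rho>. \<forall>z\<in>A. cmod (f z) \<le> w (cmod z)"
proof -
  obtain \<zeta> where \<zeta>: "closure A \<inter> sphere 0 1 = {\<zeta>}" using assms(9) by blast
  have \<rho>: "\<rho> n < 1" "0 \<le> \<rho> n" for n using assms(1) by auto
  obtain D :: "(complex \<Rightarrow> complex) set" where D: "countable D" "\<forall>\<psi>\<in>D. continuous_on (sphere 0 1) \<psi>"
    and D_all: "\<forall>\<phi> e. continuous_on (sphere 0 1) \<phi> \<longrightarrow> e > 0 \<longrightarrow>
      (\<exists>\<psi>\<in>D. \<forall>z\<in>sphere 0 1. cmod (\<psi> z - \<phi> z) < e)"
    using countable_dense_continuous_sphere by (elim exE conjE) (rule that, assumption+)
  have dense: "\<exists>\<psi>\<in>D. \<forall>z\<in>sphere 0 1. cmod (\<psi> z - \<phi> z) < e"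
    if "continuous_on (sphere 0 1) \<phi>" "e > 0" for \<phi> e
    using D_all that by simp
  obtain \<K> :: "complex set set" where \<K>: "countable \<K>"
    "\<forall>K\<in>\<K>. compact K \<and> K \<subseteq> sphere 0 1 \<and> K \<noteq> sphere 0 1"
    and \<K>_all: "\<forall>K. compact K \<longrightarrow> K \<subseteq> sphere 0 1 \<longrightarrow> K \<noteq> sphere 0 1 \<longrightarrow> (\<exists>K'\<in>\<K>. K \<subseteq> K')"
    using countable_exhausting_proper_compacts by (elim exE conjE) (rule that, assumption+)
  have exhausting: "\<exists>K'\<in>\<K>. K \<subseteq> K'" if "compact K" "K \<subseteq> sphere 0 1" "K \<noteq> sphere 0 1" for K
    using \<K>_all that by simp
  define X where "X = \<K> \<times> D"
  have ctX: "countable X" using \<K>(1) D(1) by (simp add: X_def)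
  obtain \<psi>0 where \<psi>0: "\<psi>0 \<in> D" using dense[of "\<lambda>_. 0" 1] by auto
  obtain K0 where K0: "K0 \<in> \<K>"
  proof -
    have "(1::complex) \<in> sphere 0 1" by simp
    then have "{} \<noteq> sphere (0::complex) 1" by blast
    then have "\<exists>K'\<in>\<K>. {} \<subseteq> K'" by (intro exhausting) auto
    then show ?thesis using that by blast
  qed
  have X0: "X \<noteq> {}" unfolding X_def using \<psi>0 K0 by blast
  \<comment> \<open>The first component of \<open>prod_decode\<close> takes each value infinitely
    often, so every pair in \<open>X\<close> recurs beyond any stage.\<close>
  define tg where "tg k = from_nat_into X (fst (prod_decode k))" for k
  have tg: "tg k \<in> X" for k using from_nat_into[OF X0] by (simp add: tg_def)
  have frequent: "\<exists>k\<ge>N. tg k = x" if x: "x \<in> X" for x N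
  proof -
    obtain i where "from_nat_into X i = x" using from_nat_into_surj[OF ctX x] by blast
    then show ?thesis
      by (intro exI[of _ "prod_encode (i, N)"]) (simp add: tg_def le_prod_encode_2)
  qed
  have tgK: "compact (fst (tg k))" "fst (tg k) \<subseteq> sphere 0 1" "fst (tg k) \<noteq> sphere 0 1"
    and tgD: "continuous_on (sphere 0 1) (snd (tg k))" for k
    using tg[of k] \<K>(2) D(2) by (auto simp: X_def)
  \<comment> \<open>The state is the current entire function, the index of the dilation just
    treated, and a radius. Starting from 0 settles the points of \<open>A\<close> in the first
    disc.\<close>
  define Inv :: "nat \<Rightarrow> (complex \<Rightarrow> complex) \<times> nat \<times> real \<Rightarrow> bool" where
    "Inv k x \<longleftrightarrow> (case x of (F, n, R) \<Rightarrow> F holomorphic_on UNIV \<and> 0 \<le> R \<and> R < 1 \<and> (k = 0 \<longrightarrow> F = (\<lambda>_. 0)))" for k x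
  \<comment> \<open>\<open>\<rho> n \<le> S\<close> puts the circle of the previous dilation inside
    the new disc, so later corrections hardly disturb it;
    \<open>1 - 1 / real (Suc k) \<le> S\<close> makes the discs exhaust the unit disc;
    \<open>k \<le> m\<close> sends the dilation indices to infinity.\<close>
  define Next :: "nat \<Rightarrow> (complex \<Rightarrow> complex) \<times> nat \<times> real \<Rightarrow> (complex \<Rightarrow> complex) \<times> nat \<times> real \<Rightarrow> bool" where
    "Next k x y \<longleftrightarrow> (case x of (F, n, R) \<Rightarrow> case y of (G, m, S) \<Rightarrow>
      R \<le> S \<and> \<rho> n \<le> S \<and> 1 - 1 / real (Suc k) \<le> S \<and> k \<le> m
      \<and> (\<forall>z\<in>cball 0 S. cmod (G z - F z) \<le> (1/2) ^ Suc k)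
      \<and> (\<forall>z\<in>fst (tg k). cmod (dilate G (\<rho> m) z - snd (tg k) z) \<le> (1/2) ^ Suc k)
      \<and> (\<forall>z\<in>A. S \<le> cmod z \<longrightarrow> cmod (G z) + 1 \<le> w (cmod z)))" for k x y
  have "\<exists>x. \<forall>k. Inv k (x k) \<and> Next k (x k) (x (Suc k))"
  proof (rule dependent_nat_choice)
    show "\<exists>x. Inv 0 x" by (intro exI[of _ "((\<lambda>_. 0), 0, 0)"]) (simp add: Inv_def)
    fix x k assume x: "Inv k x"
    obtain F n R where xeq: "x = (F, n, R)" by (cases x)
    have F: "F holomorphic_on UNIV" "0 \<le> R" "R < 1" using x by (auto simp: Inv_def xeq)
    define R1 where "R1 = max R (max (\<rho> n) (1 - 1 / real (Suc k)))"
    have R1: "0 \<le> R1" "R1 < 1" "R \<le> R1" "\<rho> n \<le> R1" "1 - 1 / real (Suc k) \<le> R1"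
      using F(2,3) \<rho>[of n] by (auto simp: R1_def)
    have e: "0 < (1/2::real) ^ Suc k" "(1/2::real) ^ Suc k \<le> 1" by (simp, intro power_le_one) auto
    obtain G m S where G: "G holomorphic_on UNIV" "R1 \<le> S" "S < 1" "k \<le> m"
      "\<forall>z\<in>cball 0 S. cmod (G z - F z) \<le> (1/2) ^ Suc k"
      "\<forall>z\<in>fst (tg k). cmod (dilate G (\<rho> m) z - snd (tg k) z) \<le> (1/2) ^ Suc k"
      "\<forall>z\<in>A. S \<le> cmod z \<longrightarrow> cmod (G z) + 1 \<le> w (cmod z)"
      using growth_step[where N = k, OF F(1) tgD[of k] tgK[of k] assms(8) \<zeta> \<rho>(1) assms(3,7) R1(1,2) e]
      by (elim exE conjE) (rule that, assumption+)
    have "Inv (Suc k) (G, m, S)" using G R1 by (simp add: Inv_def)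
    moreover have "Next k x (G, m, S)"
      unfolding Next_def xeq prod.case
      by (intro conjI G(4-7) order_trans[OF R1(3) G(2)] order_trans[OF R1(4) G(2)] order_trans[OF R1(5) G(2)])
    ultimately show "\<exists>y. Inv (Suc k) y \<and> Next k x y" by blast
  qed
  then obtain x where x_all: "\<forall>k. Inv k (x k) \<and> Next k (x k) (x (Suc k))" ..
  have x: "Inv k (x k)" "Next k (x k) (x (Suc k))" for k using x_all by auto
  define F where "F k = fst (x k)" for k
  define n where "n k = fst (snd (x k))" for k
  define R where "R k = snd (snd (x k))" for k
  have xk: "x k = (F k, n k, R k)" for k by (simp add: F_def n_def R_def)
  have F: "F k holomorphic_on UNIV" and R: "R k < 1" for k
    using x(1)[of k] by (auto simp: Inv_def xk)
  have F0: "F 0 = (\<lambda>_. 0)" using x(1)[of 0] by (simp add: Inv_def xk)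
  have R_step: "R k \<le> R (Suc k)" and \<rho>R: "\<rho> (n k) \<le> R (Suc k)" and R_large: "1 - 1 / real (Suc k) \<le> R (Suc k)"
    and n_large: "k \<le> n (Suc k)"
    and incr: "\<And>z. cmod z \<le> R (Suc k) \<Longrightarrow> cmod (F (Suc k) z - F k z) \<le> (1/2) ^ Suc k"
    and target: "\<And>z. z \<in> fst (tg k) \<Longrightarrow> cmod (dilate (F (Suc k)) (\<rho> (n (Suc k))) z - snd (tg k) z) \<le> (1/2) ^ Suc k"
    and growth: "\<And>z. z \<in> A \<Longrightarrow> R (Suc k) \<le> cmod z \<Longrightarrow> cmod (F (Suc k) z) + 1 \<le> w (cmod z)" for k
    using x(2)[of k] by (auto simp: Next_def xk)
  have R_mono: "R i \<le> R j" if "i \<le> j" for i j using lift_Suc_mono_le[of R, OF R_step that] .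
  define f where "f z = lim (\<lambda>k. F k z)" for z
  have tail: "cmod (f z - F k z) \<le> (1/2) ^ k" if "cmod z \<le> R (Suc k)" for z k
    unfolding f_def
  proof (rule lim_of_halving_increments[OF _ order_refl])
    fix j assume "k \<le> j"
    then have "cmod z \<le> R (Suc j)" using that R_mono[of "Suc k" "Suc j"] by simp
    then show "cmod (F (Suc j) z - F j z) \<le> (1/2) ^ Suc j" by (rule incr)
  qed
  have radius: "\<exists>k. r < R (Suc k)" if r: "r < 1" for r
  proof -
    obtain k where "inverse (real (Suc k)) < 1 - r" using reals_Archimedean[of "1 - r"] r by auto
    then show ?thesis using R_large[of k] by (intro exI[of _ k]) (simp add: inverse_eq_divide)
  qed
  have hol: "f holomorphic_on ball 0 1"
  proof (rule holomorphic_uniform_sequence[of _ F])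
    show "F k holomorphic_on ball 0 1" for k using F holomorphic_on_subset by blast
    fix z :: complex assume "z \<in> ball 0 1"
    then have z: "cmod z < 1" by simp
    define d where "d = (1 - cmod z) / 2"
    have d: "d > 0" "cmod z + d < 1" using z by (auto simp: d_def field_simps)
    obtain k where k: "cmod z + d < R (Suc k)" using radius[OF d(2)] by blast
    have le: "cmod y \<le> cmod z + d" if "y \<in> cball z d" for y
      using that norm_triangle_ineq2[of y z] by (simp add: dist_norm norm_minus_commute)
    have "uniform_limit (cball z d) F f sequentially"
    proof (rule uniform_limitI)
      fix e :: real assume "e > 0"
      then obtain N where N: "(1/2::real) ^ N < e" using real_arch_pow_inv[of e "1/2"] by auto
      show "\<forall>\<^sub>F j in sequentially. \<forall>y\<in>cball z d. dist (F j y) (f y) < e"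
        using eventually_ge_at_top[of "max N k"]
      proof eventually_elim
        case (elim j)
        have "(1/2::real) ^ j \<le> (1/2) ^ N" using elim by (intro power_decreasing) auto
        then have "(1/2::real) ^ j < e" using N by linarith
        moreover have "cmod (f y - F j y) \<le> (1/2) ^ j" if "y \<in> cball z d" for y
          using le[OF that] k R_mono[of "Suc k" "Suc j"] elim by (intro tail) auto
        ultimately show ?case
          unfolding dist_norm by (metis norm_minus_commute order_le_less_trans)
      qed
    qed
    moreover have "cball z d \<subseteq> ball 0 1" using le d(2) by fastforce
    ultimately show "\<exists>d>0. cball z d \<subseteq> ball 0 1 \<and> uniform_limit (cball z d) F f sequentially"
      using d(1) by blast
  qed simp
  have bound: "cmod (f z) \<le> w (cmod z)" if z: "z \<in> A" for z
  proof -
    have z1: "cmod z < 1" using z assms(8) by auto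
    \<comment> \<open>The first disc containing \<open>z\<close>. For \<open>k = Suc i\<close> the
      point is outside the preceding radius, where \<open>F k\<close> obeys the growth bound with
      slack 1; for \<open>k = 0\<close> the function \<open>F 0\<close> vanishes and
      \<open>1 \<le> w\<close> suffices.\<close>
    define k where "k = (LEAST k. cmod z < R (Suc k))"
    have k: "cmod z < R (Suc k)" unfolding k_def using radius[OF z1] by (rule LeastI_ex)
    have t: "cmod (f z - F k z) \<le> (1/2) ^ k" using k by (intro tail) auto
    have "(1/2::real) ^ k \<le> 1" by (intro power_le_one) auto
    then have fz: "cmod (f z) \<le> cmod (F k z) + 1"
      using t norm_triangle_ineq2[of "f z" "F k z"] by linarith
    show ?thesis
    proof (cases k)
      case 0
      then have "cmod (f z) \<le> 1" using fz by (simp add: F0)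
      also have "1 \<le> w (cmod z)" using bspec[OF assms(6)] z1 by simp
      finally show ?thesis .
    next
      case (Suc i)
      have "\<not> cmod z < R (Suc i)" using not_less_Least[of i "\<lambda>k. cmod z < R (Suc k)"] Suc by (simp add: k_def)
      then show ?thesis using growth[OF z, of i] fz Suc by simp
    qed
  qed
  have "f \<in> U_A \<rho>"
    unfolding U_A_def mem_Collect_eq
  proof (intro conjI allI impI hol)
    fix K and \<phi> :: "complex \<Rightarrow> complex"
    assume "compact K \<and> K \<subseteq> sphere 0 1 \<and> K \<noteq> sphere 0 1 \<and> continuous_on K \<phi>"
    then have K: "compact K" "K \<subseteq> sphere 0 1" "K \<noteq> sphere 0 1" and \<phi>: "continuous_on K \<phi>" by simp_all
    obtain K' where K': "K' \<in> \<K>" "K \<subseteq> K'" using exhausting[OF K] by blast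
    have clK: "closedin (top_of_set (sphere 0 1)) K"
      using K by (simp add: closed_subset compact_imp_closed)
    \<comment> \<open>The functions in \<open>D\<close> approximate on the whole circle, so
      \<open>\<phi>\<close> is first extended from \<open>K\<close> by Dugundji's theorem.\<close>
    obtain g where g: "continuous_on (sphere 0 1) g" "\<And>z. z \<in> K \<Longrightarrow> g z = \<phi> z"
      by (rule Dugundji[OF convex_UNIV UNIV_not_empty clK \<phi> subset_UNIV], rule that) blast+
    show "\<exists>n. strict_mono n \<and> uniform_limit K (\<lambda>k. dilate f (\<rho> (n k))) \<phi> sequentially"
    proof (rule subsequence_from_frequent_approximation[of K "\<lambda>n. dilate f (\<rho> n)"])
      fix N and e :: real assume e: "e > 0"
      obtain \<psi> where \<psi>: "\<psi> \<in> D" "\<And>z. z \<in> sphere 0 1 \<Longrightarrow> cmod (\<psi> z - g z) < e / 2"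
        using dense[OF g(1), of "e / 2"] e by auto
      \<comment> \<open>Two errors of size \<open>(1/2) ^ Suc k\<close>, each below
        \<open>e / 4\<close>, and one below \<open>e / 2\<close> add up to less than
        \<open>e\<close>.\<close>
      obtain M where M: "(1/2::real) ^ M < e / 4" using real_arch_pow_inv[of "e / 4" "1/2"] e by auto
      obtain k where k: "max N M \<le> k" "tg k = (K', \<psi>)"
        using frequent[of "(K', \<psi>)" "max N M"] K'(1) \<psi>(1) by (auto simp: X_def)
      have small: "(1/2::real) ^ Suc k < e / 4"
      proof -
        have "(1/2::real) ^ Suc k \<le> (1/2) ^ M" using k(1) by (intro power_decreasing) auto
        then show ?thesis using M by linarith
      qed
      have "dist (dilate f (\<rho> (n (Suc k))) z) (\<phi> z) < e" if z: "z \<in> K" for z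
      proof -
        let ?y = "of_real (\<rho> (n (Suc k))) * z"
        have z1: "cmod z = 1" using z K(2) by auto
        \<comment> \<open>The dilation index belongs to stage \<open>Suc k\<close>; its circle lies
          within the radius of the next stage, where \<open>tail\<close> compares \<open>f\<close>
          with \<open>F (Suc k)\<close>.\<close>
        then have "cmod ?y \<le> R (Suc (Suc k))" using \<rho>R[of "Suc k"] \<rho>(2) by (simp add: norm_mult)
        then have "cmod (f ?y - F (Suc k) ?y) \<le> (1/2) ^ Suc k" by (rule tail)
        moreover have "cmod (F (Suc k) ?y - \<psi> z) \<le> (1/2) ^ Suc k"
          using target[of z k] k(2) z K'(2) by (auto simp: dilate_def)
        moreover have "cmod (\<psi> z - \<phi> z) < e / 2" using \<psi>(2)[of z] z1 unfolding g(2)[OF z] by simp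
        ultimately show ?thesis
          using small norm_triangle_ineq[of "f ?y - F (Suc k) ?y" "F (Suc k) ?y - \<psi> z"]
            norm_triangle_ineq[of "f ?y - \<psi> z" "\<psi> z - \<phi> z"]
          by (simp add: dilate_def dist_norm)
      qed
      moreover have "N \<le> n (Suc k)" using n_large[of k] k(1) by simp
      ultimately show "\<exists>n\<ge>N. \<forall>z\<in>K. dist (dilate f (\<rho> n) z) (\<phi> z) < e" by blast
    qed
  qed
  then show ?thesis using bound by blast
qed

end
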